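(* Let $K$ be a field of characteristic $p>2$, let $f,g\in K[X]$ be additive polynomials with $f'(0)\,g'(0)\ne 0$, and let $F(X):=X f(X)$ and $G(X):=X g(X)$. Then: (1) $F(X)-G(Y)$ is reducible in $K[X,Y]$ if and only if $g(Y)=\delta\cdot f(\delta Y)$ for some $\delta\in\bar K^*$ such that either $\deg(f)>1$ or $\delta\in K$. (2) If $g(Y)=\delta\cdot f(\delta Y)$ for some $\delta\in\bar K^*$, and $\deg(g)>1$, then $\delta^2\in K$ and $F(X)-G(Y)$ is the product of $(X-\delta Y)$, $(X+\delta Y)$, and an irreducible polynomial in $K[X,Y]$.
   Context: A polynomial $f(X)\in K[X]$, where $K$ has characteristic $p>0$, is additive if $f(X+Y)=f(X)+f(Y)$ as polynomials; equivalently $f(X)=\sum_{i=0}^m \alpha_i X^{p^i}$ with $\alpha_i\in K$. $\bar K$ denotes an algebraic closure of $K$. *)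

theory Defs
  imports "HOL-Algebra.Algebraic_Closure_Type"
begin

text \<open>
  \<open>K[X,Y]\<close> is represented as \<open>K[X][Y]\<close>: the outer polynomial variable is \<open>Y\<close>, and its coefficients
  are polynomials in \<open>X\<close>.
\<close>

definition varX :: "'a::comm_ring_1 poly poly" where
  "varX = [:[:0, 1:]:]"

definition varY :: "'a::comm_ring_1 poly poly" where
  "varY = [:0, 1:]"

text \<open>\<open>subst2 f P\<close> is \<open>f(P)\<close>, for \<open>f\<close> univariate over \<open>K\<close> and \<open>P\<close> in \<open>K[X,Y]\<close>.\<close>

definition subst2 :: "'a::comm_ring_1 poly \<Rightarrow> 'a poly poly \<Rightarrow> 'a poly poly" where
  "subst2 f P = poly (map_poly (\<lambda>c. [:[:c:]:]) f) P"

text \<open>Additivity is an identity of polynomials, not merely of the induced function on \<open>K\<close>.\<close>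

definition additive_poly :: "'a::comm_ring_1 poly \<Rightarrow> bool" where
  "additive_poly f \<longleftrightarrow> subst2 f (varX + varY) = subst2 f varX + subst2 f varY"

definition reducible :: "'a::comm_semiring_1 \<Rightarrow> bool" where
  "reducible P \<longleftrightarrow> P \<noteq> 0 \<and> \<not> P dvd 1 \<and> \<not> irreducible P"

end

theory Submission
  imports Defs
begin

text \<open>
  Let F = X f and G = Y g. If F(X) - G(Y) = Q A B, then the ideal (A, B) contains both partial
  derivatives F'(X) and G'(Y), which are separable additive polynomials; so (A, B) is radical,
  with finitely many zeros in V \<times> W for the root groups V of F' and W of G'.
  The leading forms of A and B, for the weights that make the leading form
  of F(X) - G(Y) homogeneous, are coprime because that form is squarefree. This bounds from below
  the degree of a polynomial in X alone, or in Y alone, lying in (A, B), and hence the number of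
  coordinates of common zeros. At a common zero
  \<open>f'(0) x\<^sup>2 = g'(0) y\<^sup>2\<close>, that is, x = c y or x = - c y for a fixed c. For Q = 1 the common
  zeros therefore give more than half of the group V in the subgroup V \<inter> c W, and likewise for W,
  so V = c W, which forces g(Y) = c f(c Y). Conversely, in that case
  \<open>Q = X\<^sup>2 - c\<^sup>2 Y\<^sup>2\<close> divides F(X) - G(Y), and Q vanishes at every common zero of two factors A, B of
  the cofactor; this is impossible because all critical points of F are simple.
\<close>

section \<open>Homomorphisms and evaluation of bivariate polynomials\<close>

locale coeff_hom =
  fixes h :: "'a::comm_ring_1 \<Rightarrow> 'b::comm_ring_1"
  assumes hom_one: "h 1 = 1"
    and hom_add: "h (a + b) = h a + h b"
    and hom_mult: "h (a * b) = h a * h b"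
begin

lemma hom_zero [simp]: "h 0 = 0"
  using hom_add[of 0 0] by simp

lemma hom_uminus: "h (- a) = - h a"
  using hom_add[of a "- a"] by (simp add: eq_neg_iff_add_eq_0 add.commute)

lemma hom_diff: "h (a - b) = h a - h b"
  using hom_add[of a "- b"] by (simp add: hom_uminus)

lemma hom_prod: "h (prod f A) = (\<Prod>x\<in>A. h (f x))"
  by (induction A rule: infinite_finite_induct) (simp_all add: hom_one hom_mult)

lemma map_poly_hom_pCons: "map_poly h (pCons a p) = pCons (h a) (map_poly h p)"
  by (simp add: map_poly_pCons)

lemma map_poly_hom_add: "map_poly h (p + q) = map_poly h p + map_poly h q"
  by (rule poly_eqI) (simp add: coeff_map_poly hom_add)

lemma map_poly_hom_smult: "map_poly h (smult a p) = smult (h a) (map_poly h p)"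
  by (rule poly_eqI) (simp add: coeff_map_poly hom_mult)

lemma map_poly_hom_mult: "map_poly h (p * q) = map_poly h p * map_poly h q"
  by (induction p)
    (simp_all add: map_poly_hom_pCons map_poly_hom_add map_poly_hom_smult)

lemma coeff_hom_map_poly: "coeff_hom (map_poly h)"
  by unfold_locales (simp_all add: map_poly_hom_add map_poly_hom_mult hom_one)

lemma poly_map_poly_hom: "poly (map_poly h p) (h x) = h (poly p x)"
  by (induction p) (simp_all add: map_poly_hom_pCons hom_add hom_mult)

lemma coeff_hom_eval: "coeff_hom (\<lambda>p. poly (map_poly h p) x)"
  by unfold_locales (simp_all add: map_poly_hom_add map_poly_hom_mult hom_one)

end

text \<open>The coefficient map \<open>h\<close> stays a parameter: the identity gives values at
  points, and an embedding of K into a polynomial ring gives the weighted substitution.\<close>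

definition eval2 ::
  "('a::comm_ring_1 \<Rightarrow> 'b::comm_ring_1) \<Rightarrow> 'b \<Rightarrow> 'b \<Rightarrow> 'a poly poly \<Rightarrow> 'b" where
  "eval2 h x y A = poly (map_poly (\<lambda>c. poly (map_poly h c) x) A) y"

lemma (in coeff_hom) coeff_hom_eval2: "coeff_hom (eval2 h x y)"
proof -
  interpret e: coeff_hom "\<lambda>c. poly (map_poly h c) x" by (rule coeff_hom_eval)
  show ?thesis unfolding eval2_def by (rule e.coeff_hom_eval)
qed

lemma (in coeff_hom) eval2_simps [simp]:
  "eval2 h x y [:[:c:]:] = h c" "eval2 h x y varX = x" "eval2 h x y varY = y"
  "eval2 h x y 0 = 0"
  by (simp_all add: eval2_def varX_def varY_def map_poly_pCons hom_one)

lemma (in coeff_hom) eval2_pCons: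
  "eval2 h x y (pCons a A) = poly (map_poly h a) x + y * eval2 h x y A"
proof -
  interpret e: coeff_hom "\<lambda>c. poly (map_poly h c) x" by (rule coeff_hom_eval)
  show ?thesis by (simp add: eval2_def e.map_poly_hom_pCons)
qed

lemma (in coeff_hom) eval2_subst2:
  "eval2 h x y (subst2 f P) = poly (map_poly h f) (eval2 h x y P)"
proof -
  interpret e: coeff_hom "eval2 h x y" by (rule coeff_hom_eval2)
  show ?thesis
    unfolding subst2_def
    by (subst e.poly_map_poly_hom [symmetric])
      (simp add: map_poly_map_poly o_def)
qed

interpretation const_hom: coeff_hom "\<lambda>c::'a::comm_ring_1. [:c:]"
  by unfold_locales (simp_all add: one_pCons)

interpretation const2_hom: coeff_hom "\<lambda>c::'a::comm_ring_1. [:[:c:]:]"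
  by unfold_locales (simp_all add: one_pCons)

interpretation id_hom: coeff_hom "\<lambda>c::'a::comm_ring_1. c"
  by unfold_locales simp_all

\<comment> \<open>the instance is 0 = 0, on which the simplifier does not terminate\<close>
declare id_hom.hom_zero [simp del]

interpretation to_ac_hom: coeff_hom "to_ac :: 'a::field \<Rightarrow> 'a alg_closure"
  by unfold_locales simp_all

abbreviation eval_pt :: "'a \<Rightarrow> 'a \<Rightarrow> 'a::comm_ring_1 poly poly \<Rightarrow> 'a" where
  "eval_pt \<equiv> eval2 (\<lambda>c. c)"

lemma eval_pt_altdef: "eval_pt x y A = poly (poly A [:y:]) x"
  by (induction A) (simp_all add: id_hom.eval2_pCons)

interpretation eval_pt_hom: coeff_hom "eval_pt x y"
  by (rule id_hom.coeff_hom_eval2)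

lemma subst2_varX: "subst2 f varX = [:f:]"
proof (induction f)
  case (pCons a f)
  then show ?case
    by (simp add: subst2_def const2_hom.map_poly_hom_pCons varX_def)
qed (simp add: subst2_def)

lemma subst2_varY: "subst2 f varY = map_poly (\<lambda>c. [:c:]) f"
  by (induction f)
    (simp_all add: subst2_def const2_hom.map_poly_hom_pCons const_hom.map_poly_hom_pCons varY_def)

lemma map_poly_subst2:
  assumes "coeff_hom h"
  shows "map_poly (map_poly h) (subst2 f P) = subst2 (map_poly h f) (map_poly (map_poly h) P)"
proof -
  interpret coeff_hom h by fact
  interpret m: coeff_hom "map_poly h" by (rule coeff_hom_map_poly)
  interpret mm: coeff_hom "map_poly (map_poly h)" by (rule m.coeff_hom_map_poly)
  show ?thesis
    unfolding subst2_def
    by (subst mm.poly_map_poly_hom [symmetric])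
      (simp add: map_poly_map_poly o_def map_poly_hom_pCons m.map_poly_hom_pCons)
qed

lemma map_poly_varX: "h 0 = 0 \<Longrightarrow> h 1 = 1 \<Longrightarrow> map_poly (map_poly h) varX = varX"
  and map_poly_varY: "h 0 = 0 \<Longrightarrow> h 1 = 1 \<Longrightarrow> map_poly (map_poly h) varY = varY"
  by (simp_all add: varX_def varY_def map_poly_pCons)

section \<open>The difference of a polynomial in X and a polynomial in Y\<close>

definition diff_poly :: "'a::comm_ring_1 poly \<Rightarrow> 'a poly \<Rightarrow> 'a poly poly" where
  "diff_poly F G = subst2 F varX - subst2 G varY"

lemma diff_poly_altdef: "diff_poly F G = [:F:] - map_poly (\<lambda>c. [:c:]) G"
  by (simp add: diff_poly_def subst2_varX subst2_varY)

lemma eval_pt_diff_poly: "eval_pt x y (diff_poly F G) = poly F x - poly G y"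
  by (simp add: diff_poly_def eval_pt_hom.hom_diff id_hom.eval2_subst2)

lemma degree_diff_poly:
  assumes "degree G > 0"
  shows "degree (diff_poly F G) = degree G" "lead_coeff (diff_poly F G) = [:- lead_coeff G:]"
proof -
  let ?G = "map_poly (\<lambda>c. [:c:]) G"
  have dG: "degree ?G = degree G"
    by (intro degree_map_poly) auto
  have lG: "lead_coeff ?G = [:lead_coeff G:]"
    by (metis dG coeff_map_poly pCons_0_0)
  have e: "diff_poly F G = - (?G + [:- F:])"
    by (simp add: diff_poly_altdef)
  have "degree [:- F:] < degree ?G" using assms dG by simp
  hence "degree (?G + [:- F:]) = degree ?G" "lead_coeff (?G + [:- F:]) = lead_coeff ?G"
    by (simp_all add: degree_add_eq_left coeff_eq_0)
  thus "degree (diff_poly F G) = degree G" "lead_coeff (diff_poly F G) = [:- lead_coeff G:]"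
    unfolding e degree_minus using dG lG by (simp_all only: coeff_minus minus_pCons) simp_all
qed

lemma map_poly_diff_poly:
  assumes "coeff_hom h"
  shows "map_poly (map_poly h) (diff_poly F G) = diff_poly (map_poly h F) (map_poly h G)"
proof -
  interpret coeff_hom h by fact
  interpret m: coeff_hom "map_poly h" by (rule coeff_hom_map_poly)
  interpret mm: coeff_hom "map_poly (map_poly h)" by (rule m.coeff_hom_map_poly)
  show ?thesis
    by (simp add: diff_poly_def mm.hom_diff map_poly_subst2[OF assms] map_poly_varX map_poly_varY
        hom_one)
qed

section \<open>The weighted leading form\<close>

text \<open>With X of weight N and Y of weight M, the leading form of a polynomial,
  dehomogenised at X = 1, is the leading coefficient in T of its image in K[u][T].\<close>

definition weighted :: "nat \<Rightarrow> nat \<Rightarrow> 'a::comm_ring_1 poly poly \<Rightarrow> 'a poly poly" where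
  "weighted N M = eval2 (\<lambda>c. [:[:c:]:]) (monom 1 N) (monom [:0, 1:] M)"

interpretation weighted_hom: coeff_hom "weighted N M"
  unfolding weighted_def by (rule const2_hom.coeff_hom_eval2)

definition lead_form :: "nat \<Rightarrow> nat \<Rightarrow> 'a::comm_ring_1 poly poly \<Rightarrow> 'a poly" where
  "lead_form N M A = lead_coeff (weighted N M A)"

lemma degree_coeff_eval_monom:
  fixes b :: "'a::comm_ring_1 poly"
  shows "degree (coeff (poly (map_poly (\<lambda>c. [:[:c:]:]) b) (monom 1 N)) e) = 0"
  by (induction b arbitrary: e)
    (auto simp: const2_hom.map_poly_hom_pCons coeff_monom_mult coeff_pCons split: nat.splits,
      (metis degree_add_le degree_pCons_0 le_zero_eq)+)

lemma weighted_pCons: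
  "weighted N M (pCons a A) =
    poly (map_poly (\<lambda>c. [:[:c:]:]) a) (monom 1 N) + monom [:0, 1:] M * weighted N M A"
  by (simp add: weighted_def const2_hom.eval2_pCons)

text \<open>Only Y brings in u, one factor u for each factor Y, so no coefficient in T can exceed
  the Y-degree.\<close>

lemma degree_coeff_weighted: "degree (coeff (weighted N M A) e) \<le> degree A"
proof (induction A arbitrary: e)
  case 0
  then show ?case by (simp add: weighted_def)
next
  case (pCons a A)
  show ?case
  proof (cases "A = 0")
    case True
    then show ?thesis unfolding weighted_pCons by (simp add: degree_coeff_eval_monom)
  next
    case False
    have "degree ([:0, 1:] * coeff (weighted N M A) (e - M)) \<le> degree (pCons a A)"
      using pCons.IH[of "e - M"] False degree_mult_le[of "[:0, 1:]" "coeff (weighted N M A) (e - M)"]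
      by auto
    then show ?thesis
      unfolding weighted_pCons
      by (auto simp: coeff_monom_mult degree_coeff_eval_monom intro!: degree_add_le)
  qed
qed

text \<open>For \<open>M > 0\<close> every term containing Y acquires a positive power of T, so no u
  is left in the constant term with respect to T.\<close>

lemma degree_coeff_weighted_0: "M > 0 \<Longrightarrow> degree (coeff (weighted N M A) 0) = 0"
  by (cases A) (simp add: weighted_pCons coeff_monom_mult degree_coeff_eval_monom)

lemma degree_lead_form: "degree (lead_form N M A) \<le> degree A"
  unfolding lead_form_def by (rule degree_coeff_weighted)

lemma weighted_subst2:
  "weighted N M (subst2 F P) = pcompose (map_poly (\<lambda>c. [:c:]) F) (weighted N M P)"
  by (simp add: weighted_def const2_hom.eval2_subst2 pcompose_altdef map_poly_map_poly o_def)

lemma weighted_X: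
  fixes F :: "'a::idom poly"
  assumes "N > 0"
  shows "degree (weighted N M (subst2 F varX)) = N * degree F"
    "lead_form N M (subst2 F varX) = [:lead_coeff F:]"
proof -
  have d: "degree (map_poly (\<lambda>c. [:c:]) F) = degree F"
    by (intro degree_map_poly) auto
  have l: "lead_coeff (map_poly (\<lambda>c. [:c:]) F) = [:lead_coeff F:]"
    by (metis d coeff_map_poly pCons_0_0)
  have w: "weighted N M varX = monom 1 N"
    by (simp add: weighted_def)
  have dm: "degree (monom (1::'a poly) N) = N"
    by (simp add: degree_monom_eq)
  show "degree (weighted N M (subst2 F varX)) = N * degree F"
    by (simp add: weighted_subst2 degree_pcompose w d dm mult.commute)
  show "lead_form N M (subst2 F varX) = [:lead_coeff F:]"
    unfolding lead_form_def weighted_subst2 w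
    using assms dm l lead_coeff_comp[of "monom (1::'a poly) N" "map_poly (\<lambda>c. [:c:]) F"]
    by simp
qed

lemma weighted_Y:
  fixes G :: "'a::idom poly"
  assumes "M > 0"
  shows "degree (weighted N M (subst2 G varY)) = M * degree G"
    "lead_form N M (subst2 G varY) = monom (lead_coeff G) (degree G)"
proof -
  have d: "degree (map_poly (\<lambda>c. [:c:]) G) = degree G"
    by (intro degree_map_poly) auto
  have l: "lead_coeff (map_poly (\<lambda>c. [:c:]) G) = [:lead_coeff G:]"
    by (metis d coeff_map_poly pCons_0_0)
  have w: "weighted N M varY = monom [:0, 1:] M"
    by (simp add: weighted_def)
  have dm: "degree (monom [:0, 1::'a:] M) = M"
    by (simp add: degree_monom_eq)
  show "degree (weighted N M (subst2 G varY)) = M * degree G"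
    by (simp add: weighted_subst2 degree_pcompose w d dm mult.commute)
  have "lead_form N M (subst2 G varY) = [:lead_coeff G:] * [:0, 1:] ^ degree G"
    unfolding lead_form_def weighted_subst2 w
    using assms dm d l lead_coeff_comp[of "monom [:0, 1::'a:] M" "map_poly (\<lambda>c. [:c:]) G"]
    by simp
  thus "lead_form N M (subst2 G varY) = monom (lead_coeff G) (degree G)"
    by (simp add: monom_altdef)
qed

section \<open>Factors of the difference polynomial\<close>

lemma diff_dvd_power_diff: "x - y dvd x ^ k - y ^ k" for x y :: "'a::comm_ring_1"
  unfolding power_diff_sumr2[of x k y] by (rule dvd_triv_left)

text \<open>The condition on \<open>degree G\<close> makes the leading form, a binomial in u of
  degree \<open>degree G\<close> with nonzero constant term, coprime to its derivative.\<close>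

locale diff_curve =
  fixes F G :: "'a::field poly"
  assumes degF: "degree F > 0" and degG: "degree G > 0"
    and char_degG: "of_nat (degree G) \<noteq> (0::'a)"
begin

abbreviation P :: "'a poly poly" where "P \<equiv> diff_poly F G"
text \<open>With X of weight \<open>degree G\<close> and Y of weight \<open>degree F\<close>, the
  images of F(X) and G(Y) have the same degree in T.\<close>

abbreviation wt :: "'a poly poly \<Rightarrow> 'a poly poly" where "wt \<equiv> weighted (degree G) (degree F)"
abbreviation lf :: "'a poly poly \<Rightarrow> 'a poly" where "lf \<equiv> lead_form (degree G) (degree F)"

lemma lf_mult: "lf (A * B) = lf A * lf B"
  by (simp add: lead_form_def weighted_hom.hom_mult lead_coeff_mult)

lemma lf_dvd: "A dvd B \<Longrightarrow> lf A dvd lf B"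
  by (auto simp: dvd_def lf_mult)

lemma weighted_P:
  "degree (wt P) = degree G * degree F"
  "lf P = [:lead_coeff F:] - monom (lead_coeff G) (degree G)"
proof -
  let ?l = "[:lead_coeff F:] - monom (lead_coeff G) (degree G)"
  let ?d = "degree G * degree F"
  note X = weighted_X[OF degG, of "degree F" F]
  note Y = weighted_Y[OF degF, of "degree G" G]
  have e: "wt P = wt (subst2 F varX) - wt (subst2 G varY)"
    by (simp add: diff_poly_def weighted_hom.hom_diff)
  have c: "coeff (wt P) ?d = ?l"
    using X Y unfolding e lead_form_def by (simp add: mult.commute)
  \<comment> \<open>The two leading forms sit in different degrees of u, namely 0 and
    \<open>degree G\<close>, so their difference cannot vanish.\<close>
  have "coeff ?l 0 \<noteq> 0" using degF degG by (auto simp: coeff_monom)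
  hence "?l \<noteq> 0" by force
  moreover have "degree (wt P) \<le> ?d"
    unfolding e using X Y by (intro degree_diff_le) (simp_all add: mult.commute)
  ultimately show d: "degree (wt P) = ?d"
    using c le_degree[of "wt P" ?d] by simp
  show "lf P = ?l" unfolding lead_form_def d by (rule c)
qed

lemma lf_P_nonzero: "lf P \<noteq> 0"
proof -
  have "coeff (lf P) 0 \<noteq> 0" using degF degG by (auto simp: coeff_monom weighted_P)
  thus ?thesis by force
qed

lemma P_nonzero: "P \<noteq> 0"
  using degree_diff_poly(1)[OF degG, of F] degG by force

text \<open>For L = \<open>lf P\<close> and m = \<open>degree G\<close>, the combination m L - u L'
  keeps only m times the constant term of L, which is nonzero in the field. By the product rule L
  and L' are both combinations of \<open>lf A\<close> and \<open>lf B\<close>, hence so is this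
  constant.\<close>

lemma lf_coprime:
  assumes "P = Q * A * B"
  obtains x y where "lf A * x + lf B * y = 1"
proof -
  define n where "n = of_nat (degree G) * lead_coeff F"
  have n: "n \<noteq> 0" using char_degG degF by (auto simp: n_def)
  define U where "U = pderiv (lf Q * lf A)"
  define V where "V = lf Q * pderiv (lf B)"
  have l: "lf P = lf Q * lf A * lf B" by (simp add: assms lf_mult)
  have d: "pderiv (lf P) = lf Q * lf A * pderiv (lf B) + lf B * U"
    unfolding l U_def by (simp add: pderiv_mult algebra_simps)
  have "smult (of_nat (degree G)) (lf P) - [:0, 1:] * pderiv (lf P) = [:n:]"
    using degG by (simp add: weighted_P pderiv_diff pderiv_monom n_def smult_diff_right
        smult_monom algebra_simps monom_Suc[symmetric] pderiv_pCons)
  hence "lf A * (smult (of_nat (degree G)) (lf Q * lf B) - [:0, 1:] * V) + lf B * (- [:0, 1:] * U)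
       = [:n:]"
    unfolding d unfolding l V_def by (simp add: algebra_simps)
  hence "[:inverse n:] * (lf A * (smult (of_nat (degree G)) (lf Q * lf B) - [:0, 1:] * V)
      + lf B * (- [:0, 1:] * U)) = [:inverse n:] * [:n:]"
    by (rule arg_cong)
  also have "\<dots> = 1" using n by (simp add: one_pCons)
  finally show thesis
    by (intro that[of "[:inverse n:] * (smult (of_nat (degree G)) (lf Q * lf B) - [:0, 1:] * V)"
          "[:inverse n:] * (- [:0, 1:] * U)"]) (simp only: algebra_simps)
qed

text \<open>Passing to the leading form can only lower the Y-degree. For P it keeps it, and degrees
  add over a factor and its cofactor, so neither of them can drop.\<close>

lemma degree_lf_dvd:
  assumes "A dvd P"
  shows "degree (lf A) = degree A"
proof -
  from assms obtain C where C: "P = A * C" by (auto elim: dvdE)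
  have nz: "A \<noteq> 0" "C \<noteq> 0" "lf A \<noteq> 0" "lf C \<noteq> 0"
    using P_nonzero lf_P_nonzero by (auto simp: C lf_mult)
  have "degree (lf A) + degree (lf C) = degree (lf P)"
    using nz by (simp add: C lf_mult degree_mult_eq)
  also have "\<dots> = degree G"
  proof -
    have "degree (monom (lead_coeff G) (degree G)) = degree G"
      using degG by (intro degree_monom_eq) auto
    hence "degree (- monom (lead_coeff G) (degree G) + [:lead_coeff F:]) = degree G"
      using degG by (subst degree_add_eq_left) simp_all
    thus ?thesis by (simp add: weighted_P)
  qed
  also have "\<dots> = degree P" using degree_diff_poly(1)[OF degG] by simp
  also have "\<dots> = degree A + degree C"
    using nz by (simp add: C degree_mult_eq)
  finally show ?thesis
    using degree_lead_form[of "degree G" "degree F" A] degree_lead_form[of "degree G" "degree F" C]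
    by linarith
qed

text \<open>As a polynomial in Y, P has a nonzero constant as leading coefficient, whose divisors in
  K[X] are constants. This is what allows division with remainder by a factor of P.\<close>

lemma lead_coeff_dvd:
  assumes "A dvd P"
  obtains c where "c \<noteq> 0" "lead_coeff A = [:c:]"
proof -
  have "lead_coeff A dvd lead_coeff P"
    using assms by (auto simp: dvd_def lead_coeff_mult)
  also have "lead_coeff P dvd 1"
    using degG by (simp add: degree_diff_poly(2)[OF degG] is_unit_const_poly_iff)
      (auto simp: dvd_field_iff)
  finally show thesis
    using that by (auto simp: is_unit_poly_iff dvd_field_iff)
qed

lemma degree_nonunit:
  assumes "A dvd P" "\<not> A dvd 1"
  shows "degree A > 0"
proof (rule ccontr)
  assume "\<not> degree A > 0"
  hence "degree A = 0" by simp
  then obtain a where a: "A = [:a:]" by (elim degree_eq_zeroE)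
  from assms(1) obtain c where "c \<noteq> 0" "lead_coeff A = [:c:]" by (rule lead_coeff_dvd)
  hence "A dvd 1" by (auto simp: a is_unit_const_poly_iff dvd_field_iff)
  thus False using assms(2) by simp
qed

lemma degree_weighted_pos:
  assumes "A dvd P" "degree A > 0"
  shows "degree (wt A) > 0"
proof (rule ccontr)
  assume "\<not> degree (wt A) > 0"
  hence "degree (lf A) = 0"
    using degree_coeff_weighted_0[OF degF, of "degree G" A] by (simp add: lead_form_def)
  thus False using assms degree_lf_dvd by simp
qed

text \<open>Write \<open>lf P\<close> as s - t with s constant and t a monomial in u. A common
  divisor of \<open>lf P\<close> and u^k divides s^k - t^k and t^k, hence the nonzero constant
  s^k.\<close>

lemma degree_lf_dvd_monom:
  assumes "A dvd P" "lf A dvd monom 1 k"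
  shows "degree A = 0"
proof -
  let ?a = "[:lead_coeff F:]" and ?b = "monom (lead_coeff G) (degree G)"
  have "lf A dvd ?a - ?b" using lf_dvd[OF assms(1)] by (simp add: weighted_P)
  also have "?a - ?b dvd ?a ^ k - ?b ^ k" 
    by (rule diff_dvd_power_diff)
  finally have 1: "lf A dvd ?a ^ k - ?b ^ k" .
  have "?b ^ k = monom (lead_coeff G ^ k) (degree G * k)"
    by (simp add: monom_power)
  also have "\<dots> = monom 1 k * monom (lead_coeff G ^ k) (degree G * k - k)"
    using degG by (simp add: mult_monom)
  finally have "lf A dvd ?b ^ k" using assms(2) by simp
  with 1 have "lf A dvd ?a ^ k" by (metis diff_add_cancel dvd_add)
  moreover have "?a ^ k dvd 1"
    using degF by (auto simp: poly_const_pow is_unit_const_poly_iff dvd_field_iff)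
  ultimately have "degree (lf A) = 0"
    by (metis dvd_trans is_unit_polyE degree_pCons_0)
  thus ?thesis using degree_lf_dvd assms by simp
qed

text \<open>Once s is reduced modulo A, the leading forms of the two summands of r A + s B cannot cancel:
  that of A would divide that of s.\<close>

lemma degree_combination:
  assumes P: "P = Q * A * B" and A: "degree A > 0" and B: "degree B > 0"
    and h: "h = r * A + s * B" and k: "lf h dvd monom 1 k"
  shows "degree (wt A) \<le> degree (wt h)" "degree (wt B) \<le> degree (wt h)"
proof -
  have AP: "A dvd P" and BP: "B dvd P" by (auto simp: P)
  have "A \<noteq> 0" using A by auto
  obtain c where c: "c \<noteq> 0" "lead_coeff A = [:c:]" using AP by (rule lead_coeff_dvd)
  \<comment> \<open>K[X] is not a field, hence pseudo-division. The leading coefficient of A is a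
    constant, so the multiplier \<open>d\<close> is a nonzero constant and affects neither the
    degree nor the divisibility of leading forms.\<close>
  obtain q s' where qs: "pseudo_divmod s A = (q, s')" by (cases "pseudo_divmod s A")
  define d where "d = c ^ (Suc (degree s) - degree A)"
  have d: "d \<noteq> 0" using c by (simp add: d_def)
  have s1: "smult [:d:] s = A * q + s'" and s2: "s' = 0 \<or> degree s' < degree A"
    using pseudo_divmod[OF \<open>A \<noteq> 0\<close> qs] by (simp_all add: c d_def poly_const_pow)
  define r' where "r' = smult [:d:] r + q * B"
  have h': "[:[:d:]:] * h = r' * A + s' * B"
  proof -
    have "[:[:d:]:] * h = smult [:d:] r * A + smult [:d:] s * B"
      unfolding h by (simp add: smult_add_right)
    thus ?thesis unfolding s1 r'_def by (simp add: algebra_simps)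
  qed
  have wd: "wt [:[:d:]:] = [:[:d:]:]"
    by (simp add: weighted_def)
  have deg: "degree (wt ([:[:d:]:] * h)) = degree (wt h)"
    unfolding weighted_hom.hom_mult wd using d by simp
  have k': "lf ([:[:d:]:] * h) dvd monom 1 k"
    unfolding lf_mult using k d by (simp add: lead_form_def wd smult_dvd_iff)
  have e: "wt ([:[:d:]:] * h) = wt r' * wt A + wt s' * wt B"
    unfolding h' by (simp add: weighted_hom.hom_mult weighted_hom.hom_add)
  have rnz: "wt r' \<noteq> 0"
  proof
    assume "wt r' = 0"
    hence "lf ([:[:d:]:] * h) = lead_coeff (wt s') * lf B"
      unfolding lead_form_def e by (simp add: lead_coeff_mult)
    hence "lf B dvd monom 1 k" using k' by (metis dvd_mult_right)
    thus False using degree_lf_dvd_monom[OF BP] B by simp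
  qed
  have snz: "wt s' \<noteq> 0"
  proof
    assume "wt s' = 0"
    hence "lf ([:[:d:]:] * h) = lead_coeff (wt r') * lf A"
      unfolding lead_form_def e by (simp add: lead_coeff_mult)
    hence "lf A dvd monom 1 k" using k' by (metis dvd_mult_right)
    thus False using degree_lf_dvd_monom[OF AP] A by simp
  qed
  have nz: "lf A \<noteq> 0" "lf B \<noteq> 0" "lf Q \<noteq> 0"
    using lf_P_nonzero by (auto simp: P lf_mult)
  hence nz': "wt A \<noteq> 0" "wt B \<noteq> 0" by (auto simp: lead_form_def)
  let ?x = "wt r' * wt A" and ?y = "wt s' * wt B"
  have nc: "lead_coeff ?x + lead_coeff ?y \<noteq> 0"
  proof
    assume "lead_coeff ?x + lead_coeff ?y = 0"
    hence "lead_coeff (wt s') * lf B = - lead_coeff (wt r') * lf A"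
      by (simp add: lead_coeff_mult lead_form_def add_eq_0_iff)
    hence 1: "lf A dvd lead_coeff (wt s') * lf B" by (metis dvd_triv_right)
    \<comment> \<open>Coprimality removes \<open>lf B\<close>; then \<open>lf A\<close> would have
      to divide the leading form of the remainder \<open>s'\<close>, whose degree in u is too
      small.\<close>
    obtain x y where xy: "lf A * x + lf B * y = 1" using P by (rule lf_coprime)
    have "lead_coeff (wt s') = lead_coeff (wt s') * (lf A * x + lf B * y)" by (simp add: xy)
    also have "\<dots> = lf A * (lead_coeff (wt s') * x) + (lead_coeff (wt s') * lf B) * y"
      by (simp only: algebra_simps)
    finally have "lf A dvd lead_coeff (wt s')"
      using 1 by (metis dvd_add dvd_mult2 dvd_triv_left)
    hence "degree (lf A) \<le> degree (lead_coeff (wt s'))"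
      using snz by (intro dvd_imp_degree_le) auto
    also have "\<dots> \<le> degree s'" by (rule degree_coeff_weighted)
    finally have "degree A \<le> degree s'" using degree_lf_dvd[OF AP] by simp
    with s2 A have "s' = 0" by auto
    thus False using snz by simp
  qed
  have "max (degree ?x) (degree ?y) \<le> degree (?x + ?y)"
  proof (cases "degree ?x = degree ?y")
    case True
    thus ?thesis using nc by (intro le_degree) auto
  next
    case False
    thus ?thesis
      by (cases "degree ?x < degree ?y") (auto simp: degree_add_eq_right degree_add_eq_left)
  qed
  also have "?x + ?y = wt ([:[:d:]:] * h)" by (rule e[symmetric])
  finally have m: "max (degree ?x) (degree ?y) \<le> degree (wt h)" using deg by simp
  show "degree (wt A) \<le> degree (wt h)" "degree (wt B) \<le> degree (wt h)"
    using m rnz snz nz' by (simp_all add: degree_mult_eq)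
qed

end

section \<open>Common zeros of two factors\<close>

definition combinations :: "'a::comm_ring_1 \<Rightarrow> 'a \<Rightarrow> 'a set" where
  "combinations A B = {r * A + s * B |r s. True}"

lemma combinationsI: "r * A + s * B \<in> combinations A B"
  by (auto simp: combinations_def)

lemma combinations_gens: "A \<in> combinations A B" "B \<in> combinations A B"
  using combinationsI[of 1 A 0 B] combinationsI[of 0 A 1 B] by simp_all

lemma combinations_add:
  "x \<in> combinations A B \<Longrightarrow> y \<in> combinations A B \<Longrightarrow> x + y \<in> combinations A B"
proof (unfold combinations_def, clarsimp)
  fix r s r' s'
  show "\<exists>u v. r * A + s * B + (r' * A + s' * B) = u * A + v * B"
    by (rule exI[of _ "r + r'"], rule exI[of _ "s + s'"]) (simp add: algebra_simps)
qed

lemma combinations_mult: "x \<in> combinations A B \<Longrightarrow> c * x \<in> combinations A B"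
proof (unfold combinations_def, clarsimp)
  fix r s
  show "\<exists>u v. c * (r * A + s * B) = u * A + v * B"
    by (rule exI[of _ "c * r"], rule exI[of _ "c * s"]) (simp add: algebra_simps)
qed

text \<open>On K[X][Y], \<open>map_poly pderiv\<close> is the partial derivative in X, whereas
  \<open>pderiv\<close> is the one in Y.\<close>

lemma map_poly_pderiv_add: "map_poly pderiv (p + q) = map_poly pderiv p + map_poly pderiv q"
  by (rule poly_eqI) (simp add: coeff_map_poly pderiv_add)

lemma map_poly_pderiv_smult:
  "map_poly pderiv (smult a p) = smult (pderiv a) p + smult a (map_poly pderiv p)"
  by (rule poly_eqI) (simp add: coeff_map_poly pderiv_mult algebra_simps)

lemma map_poly_pderiv_mult:
  "map_poly pderiv (p * q) = map_poly pderiv p * q + p * map_poly pderiv q"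
proof (induction p)
  case (pCons a p)
  then show ?case
    by (simp add: map_poly_pCons map_poly_pderiv_add map_poly_pderiv_smult algebra_simps)
qed simp

lemma pderiv_diff_poly:
  fixes F G :: "'a::idom poly"
  shows "pderiv (diff_poly F G) = - map_poly (\<lambda>c. [:c:]) (pderiv G)"
proof -
  have "pderiv (map_poly (\<lambda>c. [:c:]) G) = map_poly (\<lambda>c. [:c:]) (pderiv G)"
    by (rule poly_eqI) (simp add: coeff_pderiv coeff_map_poly of_nat_poly)
  thus ?thesis by (simp add: diff_poly_altdef pderiv_diff pderiv_pCons)
qed

lemma pderivX_diff_poly:
  fixes F G :: "'a::idom poly"
  shows "map_poly pderiv (diff_poly F G) = [:pderiv F:]"
proof (rule poly_eqI)
  fix n
  show "coeff (map_poly pderiv (diff_poly F G)) n = coeff [:pderiv F:] n"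
    by (cases n) (simp_all add: diff_poly_altdef coeff_map_poly pderiv_diff pderiv_pCons)
qed

text \<open>By the product rule every term of a derivative of Q A B still contains A or B.\<close>

lemma pderivs_in_combinations:
  fixes F G :: "'a::idom poly"
  assumes P: "diff_poly F G = Q * A * B"
  shows "[:pderiv F:] \<in> combinations A B" "map_poly (\<lambda>c. [:c:]) (pderiv G) \<in> combinations A B"
proof -
  have "[:pderiv F:] = (Q * map_poly pderiv B) * A + (map_poly pderiv (Q * A)) * B"
    unfolding pderivX_diff_poly[symmetric, of F G] P
    by (simp add: map_poly_pderiv_mult algebra_simps)
  thus "[:pderiv F:] \<in> combinations A B" using combinationsI by metis
  have "map_poly (\<lambda>c. [:c:]) (pderiv G) = - pderiv (Q * A * B)"
    unfolding P[symmetric] pderiv_diff_poly by simp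
  also have "\<dots> = (- Q * pderiv B) * A + (- pderiv (Q * A)) * B"
    by (simp add: pderiv_mult algebra_simps)
  finally show "map_poly (\<lambda>c. [:c:]) (pderiv G) \<in> combinations A B" using combinationsI by metis
qed

section \<open>Locating zeros of an ideal that contains split polynomials in X and in Y\<close>

lemma minimal_subproduct:
  fixes I :: "'a::comm_ring_1 set"
  assumes "finite V" "prod f V \<in> I"
  obtains S where "S \<subseteq> V" "prod f S \<in> I" "\<And>x. x \<in> S \<Longrightarrow> prod f (S - {x}) \<notin> I"
proof -
  obtain S where S: "S \<subseteq> V \<and> prod f S \<in> I"
    and m: "\<And>T. T \<subseteq> V \<and> prod f T \<in> I \<Longrightarrow> card S \<le> card T"
    using ex_has_least_nat[of "\<lambda>S. S \<subseteq> V \<and> prod f S \<in> I" V card] assms(2) by blast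
  show thesis
  proof (rule that[of S])
    fix x assume x: "x \<in> S"
    have "finite S" using S assms(1) finite_subset by blast
    hence "card (S - {x}) < card S" using x by (rule card_Diff1_less)
    thus "prod f (S - {x}) \<notin> I" using m[of "S - {x}"] S by auto
  qed (use S in auto)
qed

text \<open>Dropping the factor \<open>f x\<close> from a minimal subproduct leaves an
  \<open>e0\<close> outside I that \<open>f x\<close> carries into I. Repeating this for
  \<open>g\<close> in the colon ideal of all b with e0 b in I yields an \<open>e\<close> outside I
  that both \<open>f x\<close> and \<open>g y\<close> carry into I.\<close>

lemma annihilated_points:
  fixes I :: "'a::comm_ring_1 set"
  assumes V: "finite V" "prod f V \<in> I" and W: "finite W" "prod g W \<in> I"
    and I: "\<And>a b. b \<in> I \<Longrightarrow> a * b \<in> I"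
  obtains S where "S \<subseteq> V" "prod f S \<in> I"
    "\<And>x. x \<in> S \<Longrightarrow> \<exists>y\<in>W. \<exists>e. e \<notin> I \<and> f x * e \<in> I \<and> g y * e \<in> I"
proof -
  obtain S where S: "S \<subseteq> V" "prod f S \<in> I" "\<And>x. x \<in> S \<Longrightarrow> prod f (S - {x}) \<notin> I"
    using V by (rule minimal_subproduct) auto
  show thesis
  proof (rule that[of S])
    fix x assume x: "x \<in> S"
    define e0 where "e0 = prod f (S - {x})"
    have fS: "finite S" using S V finite_subset by blast
    have e0: "f x * e0 = prod f S" unfolding e0_def using fS x by (simp add: prod.remove)
    have "prod g W \<in> {b. e0 * b \<in> I}" using W I by simp
    with W(1) obtain R where R: "R \<subseteq> W" "prod g R \<in> {b. e0 * b \<in> I}"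
      "\<And>y. y \<in> R \<Longrightarrow> prod g (R - {y}) \<notin> {b. e0 * b \<in> I}"
      by (rule minimal_subproduct) auto
    \<comment> \<open>An empty \<open>R\<close> would have product 1 and put \<open>e0\<close>
      itself into I.\<close>
    have "R \<noteq> {}" using R(2) S(3)[OF x] by (auto simp: e0_def)
    then obtain y where y: "y \<in> R" by auto
    have fR: "finite R" using R W finite_subset by blast
    define e where "e = e0 * prod g (R - {y})"
    have "e \<notin> I" using R(3)[OF y] by (simp add: e_def)
    moreover have "f x * e \<in> I"
      using I[OF S(2), of "prod g (R - {y})"] by (simp add: e_def mult_ac flip: e0)
    moreover have "g y * e \<in> I"
    proof -
      have "g y * e = e0 * prod g R"
        using fR y by (simp add: e_def prod.remove[of R y] mult_ac)
      thus ?thesis using R(2) by simp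
    qed
    ultimately show "\<exists>y\<in>W. \<exists>e. e \<notin> I \<and> f x * e \<in> I \<and> g y * e \<in> I"
      using y R(1) by blast
  qed (use S in auto)
qed

text \<open>Division with remainder by Y - y, followed by division of the remainder, a polynomial in
  X, by X - x.\<close>

lemma eval_pt_decomposition:
  fixes C :: "'a::comm_ring_1 poly poly"
  obtains U V where
    "C = U * (varX - [:[:x:]:]) + V * (varY - [:[:y:]:]) + [:[:eval_pt x y C:]:]"
proof -
  have X: "varX - [:[:x:]:] = [:[:-x, 1:]:]" and Y: "varY - [:[:y:]:] = [:- [:y:], 1:]"
    by (simp_all add: varX_def varY_def)
  define p where "p = poly C [:y:]"
  have "C = [:- [:y:], 1:] * synthetic_div C [:y:] + [:p:]"
    unfolding p_def by (rule synthetic_div_correct'[symmetric])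
  also have "p = [:-x, 1:] * synthetic_div p x + [:poly p x:]"
    by (rule synthetic_div_correct'[symmetric])
  finally have "C = [:synthetic_div p x:] * (varX - [:[:x:]:])
      + synthetic_div C [:y:] * (varY - [:[:y:]:]) + [:[:eval_pt x y C:]:]"
    unfolding X Y by (simp add: eval_pt_altdef p_def algebra_simps)
  thus thesis by (rule that)
qed

text \<open>Modulo X - x and Y - y the polynomial C is its value at (x, y). Both linear forms carry
  \<open>e\<close> into I, so this value times \<open>e\<close> lies in I; if it were nonzero,
  inverting it would put \<open>e\<close> there too.\<close>

lemma annihilated_point_zero:
  fixes C :: "'a::field poly poly"
  assumes I: "\<And>a b. b \<in> I \<Longrightarrow> a * b \<in> I" "\<And>a b. a \<in> I \<Longrightarrow> b \<in> I \<Longrightarrow> a + b \<in> I"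
    and e: "e \<notin> I" "(varX - [:[:x:]:]) * e \<in> I" "(varY - [:[:y:]:]) * e \<in> I"
    and C: "C \<in> I"
  shows "eval_pt x y C = 0"
proof (rule ccontr)
  define c where "c = eval_pt x y C"
  assume "eval_pt x y C \<noteq> 0"
  hence c: "c \<noteq> 0" by (simp add: c_def)
  obtain U V where UV: "C = U * (varX - [:[:x:]:]) + V * (varY - [:[:y:]:]) + [:[:c:]:]"
    unfolding c_def by (rule eval_pt_decomposition)
  have decomp: "k * e = e * (U * a + V * b + k) + ((- U) * (a * e) + (- V) * (b * e))"
    for k a b :: "'a poly poly"
    by (simp add: algebra_simps)
  have "[:[:c:]:] * e = e * C + ((- U) * ((varX - [:[:x:]:]) * e)
      + (- V) * ((varY - [:[:y:]:]) * e))"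
    by (subst UV) (rule decomp)
  also have "\<dots> \<in> I" by (intro I(2) I(1)[OF C] I(1)[OF e(2)] I(1)[OF e(3)])
  finally have "[:[:inverse c:]:] * ([:[:c:]:] * e) \<in> I" by (rule I(1))
  thus False using c e by (simp flip: one_pCons)
qed

lemma prod_varX: "(\<Prod>x\<in>S. varX - [:[:x:]:]) = subst2 (\<Prod>x\<in>S. [:-x, 1:]) varX"
proof -
  interpret s: coeff_hom "\<lambda>p. subst2 p (varX :: 'a poly poly)"
    unfolding subst2_def by (rule const2_hom.coeff_hom_eval)
  show ?thesis unfolding s.hom_prod unfolding subst2_varX by (simp add: varX_def)
qed

lemma prod_varY: "(\<Prod>y\<in>S. varY - [:[:y:]:]) = subst2 (\<Prod>y\<in>S. [:-y, 1:]) varY"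
proof -
  interpret s: coeff_hom "\<lambda>p. subst2 p (varY :: 'a poly poly)"
    unfolding subst2_def by (rule const2_hom.coeff_hom_eval)
  show ?thesis unfolding s.hom_prod unfolding subst2_varY by (simp add: map_poly_pCons varY_def flip: one_pCons)
qed

context diff_curve
begin

text \<open>The ideal (A, B) contains F'(X) and G'(Y), which split over V and W. Minimal subproducts
  still in the ideal give \<open>S\<close> and \<open>R\<close>: minimality places a common zero
  over each element, and membership lets \<open>degree_combination\<close> bound their sizes from
  below.\<close>

lemma common_zeros:
  assumes P: "P = Q * A * B" and A: "degree A > 0" and B: "degree B > 0"
    and V: "finite V" "c \<noteq> 0" "pderiv F = smult c (\<Prod>x\<in>V. [:-x, 1:])"
    and W: "finite W" "d \<noteq> 0" "pderiv G = smult d (\<Prod>y\<in>W. [:-y, 1:])"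
  obtains S R where "S \<subseteq> V" "R \<subseteq> W"
    "\<And>x. x \<in> S \<Longrightarrow> \<exists>y\<in>W. eval_pt x y A = 0 \<and> eval_pt x y B = 0"
    "\<And>y. y \<in> R \<Longrightarrow> \<exists>x\<in>V. eval_pt x y A = 0 \<and> eval_pt x y B = 0"
    "degree (wt A) \<le> degree G * card S" "degree (wt B) \<le> degree G * card S"
    "degree (wt A) \<le> degree F * card R" "degree (wt B) \<le> degree F * card R"
proof -
  let ?I = "combinations A B"
  let ?X = "\<lambda>x. varX - [:[:x:]:] :: 'a poly poly" and ?Y = "\<lambda>y. varY - [:[:y:]:] :: 'a poly poly"
  note I = combinations_mult[of _ A B] combinations_add[of _ A B]
  interpret sX: coeff_hom "\<lambda>p. subst2 p (varX :: 'a poly poly)"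
    unfolding subst2_def by (rule const2_hom.coeff_hom_eval)
  interpret sY: coeff_hom "\<lambda>p. subst2 p (varY :: 'a poly poly)"
    unfolding subst2_def by (rule const2_hom.coeff_hom_eval)
  have "prod ?X V = [:[:inverse c:]:] * [:pderiv F:]"
    using V(2) by (simp add: prod_varX subst2_varX V(3))
  hence VI: "prod ?X V \<in> ?I" using pderivs_in_combinations(1)[OF P] I by metis
  have "prod ?Y W = [:[:inverse d:]:] * map_poly (\<lambda>c. [:c:]) (pderiv G)"
    using W(2) by (simp add: prod_varY subst2_varY W(3) const_hom.map_poly_hom_smult
        flip: one_pCons)
  hence WI: "prod ?Y W \<in> ?I" using pderivs_in_combinations(2)[OF P] I by metis
  obtain S where S: "S \<subseteq> V" "prod ?X S \<in> ?I"
    "\<And>x. x \<in> S \<Longrightarrow> \<exists>y\<in>W. \<exists>e. e \<notin> ?I \<and> ?X x * e \<in> ?I \<and> ?Y y * e \<in> ?I"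
    by (rule annihilated_points[OF V(1) VI W(1) WI]) (use I in auto)
  obtain R where R: "R \<subseteq> W" "prod ?Y R \<in> ?I"
    "\<And>y. y \<in> R \<Longrightarrow> \<exists>x\<in>V. \<exists>e. e \<notin> ?I \<and> ?Y y * e \<in> ?I \<and> ?X x * e \<in> ?I"
    by (rule annihilated_points[OF W(1) WI V(1) VI]) (use I in auto)
  have z: "eval_pt x y A = 0 \<and> eval_pt x y B = 0"
    if "e \<notin> ?I" "?X x * e \<in> ?I" "?Y y * e \<in> ?I" for x y e
    using annihilated_point_zero[OF I that] combinations_gens by blast
  have dS: "degree (\<Prod>x\<in>T. [:-x, 1:]) = card T" for T :: "'a set"
    by (subst degree_prod_sum_eq) auto
  have lS: "lead_coeff (\<Prod>x\<in>T. [:-x, 1:]) = 1" for T :: "'a set"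
    by (simp add: lead_coeff_prod)
  obtain r s where rs: "prod ?X S = r * A + s * B" using S(2) by (auto simp: combinations_def)
  obtain r' s' where rs': "prod ?Y R = r' * A + s' * B" using R(2) by (auto simp: combinations_def)
  \<comment> \<open>The leading forms of the two products are 1 and u to the power
    \<open>card R\<close>, so both divide a power of u, as \<open>degree_combination\<close>
    requires.\<close>
  have wS: "degree (wt (prod ?X S)) = degree G * card S" "lf (prod ?X S) dvd monom 1 0"
    using weighted_X[OF degG, of "degree F" "\<Prod>x\<in>S. [:-x, 1:]"]
    unfolding prod_varX dS lS[unfolded dS] by (simp_all add: one_pCons)
  have wR: "degree (wt (prod ?Y R)) = degree F * card R" "lf (prod ?Y R) dvd monom 1 (card R)"
    using weighted_Y[OF degF, of "degree G" "\<Prod>x\<in>R. [:-x, 1:]"]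
    unfolding prod_varY dS lS[unfolded dS] by simp_all
  show thesis
  proof (rule that[of S R])
    show "degree (wt A) \<le> degree G * card S" "degree (wt B) \<le> degree G * card S"
      using degree_combination[OF P A B rs wS(2)] wS(1) by simp_all
    show "degree (wt A) \<le> degree F * card R" "degree (wt B) \<le> degree F * card R"
      using degree_combination[OF P A B rs' wR(2)] wR(1) by simp_all
  qed (use S R z in blast)+
qed

end

section \<open>Additive polynomials\<close>

text \<open>Being an identity of polynomials, additivity passes to every commutative ring that
  receives the coefficients, in particular to K[X].\<close>

lemma additive_poly_eval2:
  assumes "additive_poly f" "coeff_hom h"
  shows "poly (map_poly h f) (x + y) = poly (map_poly h f) x + poly (map_poly h f) y"
proof -
  interpret coeff_hom h by fact
  interpret e: coeff_hom "eval2 h x y" by (rule coeff_hom_eval2)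
  have "eval2 h x y (subst2 f (varX + varY)) = eval2 h x y (subst2 f varX + subst2 f varY)"
    using assms(1) by (simp add: additive_poly_def)
  thus ?thesis by (simp add: eval2_subst2 e.hom_add)
qed

lemma additive_poly_add: "additive_poly f \<Longrightarrow> poly f (x + y) = poly f x + poly f y"
  using additive_poly_eval2[of f "\<lambda>c. c" x y] id_hom.coeff_hom_axioms by simp

lemma additive_poly_0: "additive_poly f \<Longrightarrow> poly f 0 = 0"
  using additive_poly_add[of f 0 0] by simp

lemma additive_poly_minus: "additive_poly f \<Longrightarrow> poly f (- x) = - poly f x"
  using additive_poly_add[of f x "- x"]
  by (simp add: additive_poly_0 eq_neg_iff_add_eq_0 add.commute)

lemma additive_poly_map:
  assumes "additive_poly f" "coeff_hom h"
  shows "additive_poly (map_poly h f)"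
proof -
  interpret coeff_hom h by fact
  interpret m: coeff_hom "map_poly h" by (rule coeff_hom_map_poly)
  interpret mm: coeff_hom "map_poly (map_poly h)" by (rule m.coeff_hom_map_poly)
  have "map_poly (map_poly h) (subst2 f (varX + varY)) =
      map_poly (map_poly h) (subst2 f varX + subst2 f varY)"
    using assms(1) by (simp add: additive_poly_def)
  thus ?thesis
    by (simp add: additive_poly_def map_poly_subst2[OF assms(2)] mm.hom_add map_poly_varX
        map_poly_varY hom_one)
qed

text \<open>Differentiating f(X + Y) = f(X) + f(Y) in Y gives f'(X + Y) = f'(Y), and setting Y = 0
  shows that f' is constant.\<close>

lemma additive_poly_pderiv:
  fixes f :: "'a::idom poly"
  assumes "additive_poly f"
  shows "pderiv f = [:coeff f 1:]"
proof -
  let ?f = "map_poly (\<lambda>c. [:c:]) f"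
  have d: "pderiv ?f = map_poly (\<lambda>c. [:c:]) (pderiv f)"
    using pderiv_diff_poly[of 0 f] by (simp add: diff_poly_altdef pderiv_minus)
  have "subst2 f (varX + varY) = pcompose ?f [:[:0, 1:], 1:]"
    by (simp add: subst2_def pcompose_altdef map_poly_map_poly o_def varX_def varY_def)
  moreover have "subst2 f varX + subst2 f varY = [:f:] + ?f"
    by (simp add: subst2_varX subst2_varY)
  ultimately have "pderiv (pcompose ?f [:[:0, 1:], 1:]) = pderiv ([:f:] + ?f)"
    using assms by (simp add: additive_poly_def)
  hence "pcompose (map_poly (\<lambda>c. [:c:]) (pderiv f)) [:[:0, 1:], 1:]
      = map_poly (\<lambda>c. [:c:]) (pderiv f)"
    by (simp add: pderiv_pcompose pderiv_add d pderiv_pCons)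
  from arg_cong[OF this, of "\<lambda>p. poly p 0"]
  have "poly (map_poly (\<lambda>c. [:c:]) (pderiv f)) [:0, 1:]
      = poly (map_poly (\<lambda>c. [:c:]) (pderiv f)) [:0:]"
    by (simp add: poly_pcompose)
  hence "pderiv f = [:poly (pderiv f) 0:]"
    unfolding const_hom.poly_map_poly_hom unfolding pcompose_altdef[symmetric] by simp
  thus ?thesis by (simp add: poly_0_coeff_0 coeff_pderiv)
qed

text \<open>Additivity at X and -X, taken in K[X], gives f(X) + f(-X) = f(0) = 0, so twice each even
  coefficient is 0.\<close>

lemma additive_poly_coeff_even:
  fixes f :: "'a::field poly"
  assumes "additive_poly f" "(2::'a) \<noteq> 0" "even i"
  shows "coeff f i = 0"
proof -
  have "poly (map_poly (\<lambda>c. [:c:]) f) ([:0, 1:] + [:0, -1:])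
      = poly (map_poly (\<lambda>c. [:c:]) f) [:0, 1:] + poly (map_poly (\<lambda>c. [:c:]) f) [:0, -1:]"
    by (rule additive_poly_eval2[OF assms(1) const_hom.coeff_hom_axioms])
  moreover have "poly (map_poly (\<lambda>c. [:c:]) f) ([:0, 1:] + [:0, -1:]) = 0"
    using const_hom.poly_map_poly_hom[of f 0] additive_poly_0[OF assms(1)] by simp
  ultimately have "f + pcompose f [:0, -1:] = 0"
    unfolding pcompose_altdef[symmetric] by simp
  hence "coeff (f + pcompose f [:0, -1:]) i = 0" by simp
  hence "2 * coeff f i = 0" using \<open>even i\<close> by (simp add: coeff_pcompose_linear)
  thus ?thesis using assms(2) by simp
qed

text \<open>The parameters \<open>a\<close> and \<open>b\<close> are f'(0) and g'(0). The
  assumptions are symmetric, so exchanging f and g gives another instance.\<close>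

locale additive_pair =
  fixes f g :: "'a::field poly" and a b :: 'a
  assumes addf: "additive_poly f" and addg: "additive_poly g"
    and a: "a = coeff f 1" "a \<noteq> 0" and b: "b = coeff g 1" "b \<noteq> 0"
    and two: "(2::'a) \<noteq> 0"
begin

lemma swap: "additive_pair g f b a"
  using addf addg a b two by unfold_locales

lemma degree_pos: "degree f > 0"
  using a le_degree[of f 1] by fastforce

lemma degree_pCons_f: "degree (pCons 0 f) = Suc (degree f)"
  using degree_pos by auto

text \<open>Unless f is linear, constancy of f' kills the derivative of the leading term, so
  \<open>degree f\<close> is 0 in the field and its successor is 1. For linear f the value is
  2.\<close>

lemma of_nat_degree: "of_nat (degree (pCons 0 f)) \<noteq> (0::'a)"
proof (cases "degree f = 1")
  case True
  have "of_nat (degree (pCons 0 f)) = (2::'a)" by (simp only: degree_pCons_f True) simp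
  thus ?thesis using two by simp
next
  case False
  then obtain n where n: "degree f = Suc (Suc n)"
    using degree_pos by (metis One_nat_def Suc_pred gr0_implies_Suc neq0_conv)
  have "coeff (pderiv f) (Suc n) = 0"
    by (simp add: additive_poly_pderiv[OF addf])
  hence "of_nat (degree f) * lead_coeff f = 0"
    by (simp add: coeff_pderiv n)
  moreover have "lead_coeff f \<noteq> 0" using degree_pos by auto
  ultimately have "of_nat (degree f) = (0::'a)" by simp
  thus ?thesis unfolding degree_pCons_f by simp
qed

text \<open>The product rule with f' = a. The result is again additive, so the critical points of F
  form a group.\<close>

lemma pderiv_F: "pderiv (pCons 0 f) = f + [:0, a:]"
  using additive_poly_pderiv[OF addf] a by (simp add: pderiv_pCons)

lemma pderiv2_F: "pderiv (pderiv (pCons 0 f)) = [:2 * a:]"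
  using additive_poly_pderiv[OF addf] a
  by (simp add: pderiv_F pderiv_add pderiv_pCons)

lemma degree_pderiv_F: "degree (pderiv (pCons 0 f)) = degree f"
proof (cases "degree f = 1")
  case True
  have "degree (f + [:0, a:]) \<le> 1" using True by (intro degree_add_le) auto
  \<comment> \<open>The linear coefficient is a + a, nonzero outside characteristic 2.\<close>
  moreover have "coeff (f + [:0, a:]) 1 \<noteq> 0" using a two by (simp flip: mult_2)
  ultimately show ?thesis using True le_degree by (metis pderiv_F le_antisym)
next
  case False
  thus ?thesis using degree_pos unfolding pderiv_F
    by (intro degree_add_eq_left) auto
qed

lemma pderiv_F_add:
  "poly (pderiv (pCons 0 f)) (x + y) = poly (pderiv (pCons 0 f)) x + poly (pderiv (pCons 0 f)) y"
  by (simp add: pderiv_F additive_poly_add[OF addf] algebra_simps)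

lemma pderiv_F_minus: "poly (pderiv (pCons 0 f)) (- x) = - poly (pderiv (pCons 0 f)) x"
  by (simp add: pderiv_F additive_poly_minus[OF addf])

text \<open>F'(x) = 0 says f(x) = -a x, and F(x) = x f(x).\<close>

lemma critical_value: "poly (pderiv (pCons 0 f)) x = 0 \<Longrightarrow> poly (pCons 0 f) x = - a * x\<^sup>2"
  by (simp add: pderiv_F eq_neg_iff_add_eq_0[symmetric] power2_eq_square mult_ac)

end

sublocale additive_pair \<subseteq> rev: additive_pair g f b a
  by (rule swap)

sublocale additive_pair \<subseteq> diff_curve "pCons 0 f" "pCons 0 g"
  by unfold_locales (use degree_pCons_f rev.degree_pCons_f rev.of_nat_degree in simp_all)

lemma (in additive_pair) critical_common_zero:
  assumes "poly (pderiv (pCons 0 f)) x = 0" "poly (pderiv (pCons 0 g)) y = 0"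
    "P = A * B" "eval_pt x y B = 0"
  shows "a * x\<^sup>2 = b * y\<^sup>2"
proof -
  have "eval_pt x y P = 0"
    using assms by (simp add: eval_pt_hom.hom_mult)
  thus ?thesis
    using critical_value[OF assms(1)] rev.critical_value[OF assms(2)]
    by (simp only: eval_pt_diff_poly) simp
qed

section \<open>Algebraically closed fields\<close>

text \<open>A repeated root would also be a root of the derivative, which is a nonzero constant; so
  the multiset of roots is just the set of roots.\<close>

lemma separable_factorization:
  fixes v :: "'a::alg_closed_field poly"
  assumes "pderiv v = [:c:]" "c \<noteq> 0"
  defines "V \<equiv> {x. poly v x = 0}"
  shows "finite V" "v = smult (lead_coeff v) (\<Prod>x\<in>V. [:-x, 1:])" "card V = degree v"
proof -
  have nz: "v \<noteq> 0" using assms by auto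
  show fin: "finite V" unfolding V_def by (rule poly_roots_finite[OF nz])
  obtain A where A: "size A = degree v" "v = smult (lead_coeff v) (\<Prod>x\<in>#A. [:-x, 1:])"
    using alg_closed_imp_factorization[OF nz] by blast
  have c1: "count A x \<le> 1" for x
  proof (rule ccontr)
    assume "\<not> count A x \<le> 1"
    hence "{#x, x#} \<subseteq># A"
      by (auto simp: subseteq_mset_def)
    then obtain A' where "A = {#x, x#} + A'" by (auto simp: mset_subset_eq_exists_conv)
    hence "v = [:-x, 1:] * ([:-x, 1:] * smult (lead_coeff v) (\<Prod>x\<in>#A'. [:-x, 1:]))"
      using A(2) by (simp add: mult_ac)
    then obtain q where "v = [:-x, 1:] * ([:-x, 1:] * q)" by blast
    hence "poly (pderiv v) x = 0" by (simp only: pderiv_mult poly_add poly_mult) simp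
    thus False using assms by simp
  qed
  have V: "set_mset A = V"
  proof -
    have "poly v x = lead_coeff v * (\<Prod>y\<in>#A. x - y)" for x
      by (subst A(2)) (simp add: poly_prod_mset)
    thus ?thesis using nz by (auto simp: V_def prod_mset_zero_iff)
  qed
  have "A = mset_set V"
  proof (rule multiset_eqI)
    fix x
    show "count A x = count (mset_set V) x"
    proof (cases "x \<in># A")
      case True
      hence "count A x > 0" by simp
      with c1[of x] have "count A x = 1" by linarith
      thus ?thesis using True V fin by (auto simp: count_mset_set)
    next
      case False
      thus ?thesis using V by (auto simp: not_in_iff)
    qed
  qed
  thus "v = smult (lead_coeff v) (\<Prod>x\<in>V. [:-x, 1:])" "card V = degree v"
    using A by (simp_all add: prod_unfold_prod_mset)
qed

text \<open>For z in V outside U the coset z + U is disjoint from U, and both lie in V, so U would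
  fill at most half of V.\<close>

lemma subgroup_more_than_half:
  fixes U V :: "'a::ab_group_add set"
  assumes "finite V" "U \<subseteq> V" "card V < 2 * card U"
    and V: "\<And>x y. x \<in> V \<Longrightarrow> y \<in> V \<Longrightarrow> x + y \<in> V"
    and U: "\<And>x y. x \<in> U \<Longrightarrow> y \<in> U \<Longrightarrow> x - y \<in> U"
  shows "U = V"
proof (rule ccontr)
  assume "U \<noteq> V"
  then obtain z where z: "z \<in> V" "z \<notin> U" using assms(2) by auto
  have fU: "finite U" using assms finite_subset by blast
  have "z + u \<notin> U" if "u \<in> U" for u
    using U[OF _ that, of "z + u"] z by auto
  hence "U \<inter> (+) z ` U = {}" by auto
  hence "card (U \<union> (+) z ` U) = 2 * card U"
    using fU by (simp add: card_Un_disjoint card_image)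
  moreover have "card (U \<union> (+) z ` U) \<le> card V"
    using assms z V by (intro card_mono) auto
  ultimately show False using assms(3) by simp
qed

text \<open>With V and W the root groups of F' and G', U is the subgroup V \<inter> c W. Each x in
  \<open>S\<close> satisfies x^2 = (c y)^2 for some y in W, so x = c y or x = -c y, and W is closed
  under negation. Thus U contains \<open>S\<close>, more than half of the \<open>degree f\<close>
  elements of V.\<close>

lemma half_of_critical_points:
  fixes f g :: "'a::alg_closed_field poly"
  assumes "additive_pair f g a b"
    and S: "S \<subseteq> {x. poly (pderiv (pCons 0 f)) x = 0}"
    and z: "\<And>x. x \<in> S \<Longrightarrow> \<exists>y. poly (pderiv (pCons 0 g)) y = 0 \<and> a * x\<^sup>2 = b * y\<^sup>2"
    and card: "degree f < 2 * card S" and c: "a * c\<^sup>2 = b"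
    and x: "poly (pderiv (pCons 0 f)) x = 0"
  shows "poly (pderiv (pCons 0 g)) (x / c) = 0"
proof -
  interpret additive_pair f g a b by fact
  let ?v = "pderiv (pCons 0 f)" and ?w = "pderiv (pCons 0 g)"
  define V where "V = {x. poly ?v x = 0}"
  define U where "U = {x \<in> V. poly ?w (x / c) = 0}"
  have c0: "c \<noteq> 0" using c b by auto
  note V = separable_factorization[OF pderiv2_F, folded V_def]
  have ta: "2 * a \<noteq> 0" using a two by simp
  have "U = V"
  proof (rule subgroup_more_than_half)
    show "finite V" using V(1)[OF ta] .
    show "U \<subseteq> V" by (auto simp: U_def)
    have "S \<subseteq> U"
    proof
      fix x assume "x \<in> S"
      then obtain y where y: "poly ?w y = 0" "a * x\<^sup>2 = b * y\<^sup>2" using z by blast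
      have "a * x\<^sup>2 = a * (c * y)\<^sup>2" using y(2) c by (simp add: power_mult_distrib mult_ac)
      hence "x\<^sup>2 = (c * y)\<^sup>2" using a by simp
      hence "x = c * y \<or> x = - (c * y)" by (simp add: power2_eq_iff)
      hence "x / c = y \<or> x / c = - y" using c0 by auto
      hence "poly ?w (x / c) = 0" using y(1) rev.pderiv_F_minus by auto
      thus "x \<in> U" using S \<open>x \<in> S\<close> by (auto simp: U_def V_def)
    qed
    moreover have "finite U" using V(1)[OF ta] by (simp add: U_def)
    ultimately have "card S \<le> card U" by (intro card_mono)
    thus "card V < 2 * card U" using card V(3)[OF ta] degree_pderiv_F by simp
    show "x + y \<in> V" if "x \<in> V" "y \<in> V" for x y
      using that by (simp add: V_def pderiv_F_add)
    show "x - y \<in> U" if "x \<in> U" "y \<in> U" for x y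
      using that pderiv_F_add[of x "- y"] rev.pderiv_F_add[of "x / c" "- (y / c)"]
      by (simp add: U_def V_def pderiv_F_minus rev.pderiv_F_minus diff_divide_distrib)
  qed
  thus ?thesis using x by (auto simp: U_def V_def)
qed

lemma factorization_imp_scaling:
  fixes f g :: "'a::alg_closed_field poly"
  assumes "additive_pair f g a b"
    and P: "diff_poly (pCons 0 f) (pCons 0 g) = A * B" and A: "\<not> A dvd 1" and B: "\<not> B dvd 1"
  obtains c where "c \<noteq> 0" "g = smult c (pcompose f [:0, c:])"
proof -
  interpret additive_pair f g a b by fact
  let ?v = "pderiv (pCons 0 f)" and ?w = "pderiv (pCons 0 g)"
  define V where "V = {x. poly ?v x = 0}"
  define W where "W = {y. poly ?w y = 0}"
  have ta: "2 * a \<noteq> 0" and tb: "2 * b \<noteq> 0" using a b two by simp_all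
  note V = separable_factorization[OF pderiv2_F ta, folded V_def]
  note W = separable_factorization[OF rev.pderiv2_F tb, folded W_def]
  have dA: "degree A > 0" and dB: "degree B > 0"
    using degree_nonunit A B P by simp_all
  have lv: "lead_coeff ?v \<noteq> 0" "lead_coeff ?w \<noteq> 0"
    using pderiv2_F rev.pderiv2_F ta tb by auto
  have P1: "P = 1 * A * B" using P by simp
  obtain S R where SR: "S \<subseteq> V" "R \<subseteq> W"
    "\<And>x. x \<in> S \<Longrightarrow> \<exists>y\<in>W. eval_pt x y A = 0 \<and> eval_pt x y B = 0"
    "\<And>y. y \<in> R \<Longrightarrow> \<exists>x\<in>V. eval_pt x y A = 0 \<and> eval_pt x y B = 0"
    "degree (wt A) \<le> degree (pCons 0 g) * card S" "degree (wt B) \<le> degree (pCons 0 g) * card S"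
    "degree (wt A) \<le> degree (pCons 0 f) * card R" "degree (wt B) \<le> degree (pCons 0 f) * card R"
    by (rule common_zeros[OF P1 dA dB V(1) lv(1) V(2) W(1) lv(2) W(2)]) (rule that; blast)
  have "degree (wt A) + degree (wt B) = degree (wt P)"
    using weighted_P(2) lf_P_nonzero
    by (subst degree_mult_eq[symmetric]) (auto simp: P weighted_hom.hom_mult lead_form_def)
  hence deg: "degree (wt A) + degree (wt B) = degree (pCons 0 g) * degree (pCons 0 f)"
    by (simp only: weighted_P(1))
  \<comment> \<open>Adding the bounds for A and B and cancelling gives
    \<open>degree f + 1 \<le> 2 * card S\<close>; the extra 1, from the factor X in F, is what puts
    more than half of V in \<open>S\<close>.\<close>
  have "degree (pCons 0 g) * degree (pCons 0 f) \<le> degree (pCons 0 g) * (2 * card S)"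
    using SR(5,6) deg by linarith
  hence cS: "degree f < 2 * card S"
    using degree_pCons_f degG by simp
  have "degree (pCons 0 f) * degree (pCons 0 g) \<le> degree (pCons 0 f) * (2 * card R)"
    using SR(7,8) deg by (simp only: mult.commute[of "degree (pCons 0 g)"])
  hence cR: "degree g < 2 * card R"
    using rev.degree_pCons_f degF by simp
  \<comment> \<open>A square root of b / a turns a x^2 = b y^2 into x = c y or x = -c y.\<close>
  obtain c where c: "c\<^sup>2 = b / a" using nth_root_exists[of 2 "b / a"] by auto
  have c1: "a * c\<^sup>2 = b" and c2: "b * (1 / c)\<^sup>2 = a"
    using c a b by (auto simp: power_divide)
  have c0: "c \<noteq> 0" using c a b by auto
  have zS: "\<exists>y. poly ?w y = 0 \<and> a * x\<^sup>2 = b * y\<^sup>2" if x: "x \<in> S" for x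
  proof -
    obtain y where y: "y \<in> W" "eval_pt x y B = 0" using SR(3)[OF x] by blast
    thus ?thesis
      using critical_common_zero[of x y A B] x SR(1) P by (auto simp: V_def W_def)
  qed
  have zR: "\<exists>x. poly ?v x = 0 \<and> b * y\<^sup>2 = a * x\<^sup>2" if y: "y \<in> R" for y
  proof -
    obtain x where x: "x \<in> V" "eval_pt x y B = 0" using SR(4)[OF y] by blast
    have "a * x\<^sup>2 = b * y\<^sup>2"
      using critical_common_zero[of x y A B] x y SR(2) P by (auto simp: V_def W_def)
    thus ?thesis using x(1) by (auto simp: V_def)
  qed
  have VW: "poly ?w (x / c) = 0" if "poly ?v x = 0" for x
    by (rule half_of_critical_points[OF additive_pair_axioms SR(1)[unfolded V_def] zS cS c1 that])
  have WV: "poly ?v (y * c) = 0" if "poly ?w y = 0" for y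
    using half_of_critical_points[OF swap SR(2)[unfolded W_def] zR cR c2 that] by simp
  \<comment> \<open>F'(c Y) has the same simple roots as G', so the two agree up to a constant
    \<open>k\<close>.\<close>
  define v' where "v' = pcompose ?v [:0, c:]"
  have "{y. poly v' y = 0} = W"
    using VW WV c0 by (force simp: v'_def W_def poly_pcompose mult.commute)
  moreover have dv': "pderiv v' = [:2 * a * c:]"
    unfolding v'_def pderiv_pcompose pderiv2_F by (simp add: pderiv_pCons mult_ac)
  moreover have "2 * a * c \<noteq> 0" using ta c0 by simp
  ultimately have v': "v' = smult (lead_coeff v') (\<Prod>y\<in>W. [:-y, 1:])"
    using separable_factorization(2)[of v' "2 * a * c"] by simp
  have lv': "lead_coeff v' \<noteq> 0" using dv' ta c0 by auto
  define k where "k = lead_coeff ?w / lead_coeff v'"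
  have wk: "?w = smult k v'"
    by (subst W(2), subst v') (use lv' in \<open>simp add: k_def\<close>)
  \<comment> \<open>Comparing second derivatives, 2 b = 2 k a c, with b = a c^2 yields k =
    c.\<close>
  have "pderiv ?w = smult k (pderiv v')" unfolding wk by (simp add: pderiv_smult)
  hence "2 * b = k * (2 * a * c)" by (simp add: rev.pderiv2_F dv')
  hence "2 * (c * (a * c)) = 2 * (k * (a * c))" using c1 by (simp add: power2_eq_square mult_ac)
  hence "c * (a * c) = k * (a * c)" using two mult_left_cancel by blast
  hence k: "k = c" using a c0 by simp
  have "g + [:0, b:] = smult c (pcompose (f + [:0, a:]) [:0, c:])"
    using wk unfolding k v'_def pderiv_F rev.pderiv_F .
  also have "\<dots> = smult c (pcompose f [:0, c:]) + [:0, b:]"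
    by (simp add: pcompose_add pcompose_pCons smult_add_right c1[symmetric] power2_eq_square mult_ac)
  finally show thesis using c0 by (intro that[of c]) simp_all
qed

text \<open>At a common zero of three factors F(X) - G(y) would have a triple root, but its second
  derivative is a nonzero constant.\<close>

lemma two_factors_common_zero:
  fixes f g :: "'a::alg_closed_field poly"
  assumes "additive_pair f g a b"
    and P: "diff_poly (pCons 0 f) (pCons 0 g) = Q * A * B"
    and A: "\<not> A dvd 1" and B: "\<not> B dvd 1"
  obtains x y where "a * x\<^sup>2 = b * y\<^sup>2" "eval_pt x y Q \<noteq> 0"
proof -
  interpret additive_pair f g a b by fact
  let ?v = "pderiv (pCons 0 f)" and ?w = "pderiv (pCons 0 g)"
  define V where "V = {x. poly ?v x = 0}"
  define W where "W = {y. poly ?w y = 0}"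
  have ta: "2 * a \<noteq> 0" and tb: "2 * b \<noteq> 0" using a b two by simp_all
  note V = separable_factorization[OF pderiv2_F ta, folded V_def]
  note W = separable_factorization[OF rev.pderiv2_F tb, folded W_def]
  have AP: "A dvd P" and BP: "B dvd P" by (simp_all add: P)
  have dA: "degree A > 0" and dB: "degree B > 0"
    using degree_nonunit A B AP BP by simp_all
  have lv: "lead_coeff ?v \<noteq> 0" "lead_coeff ?w \<noteq> 0"
    using pderiv2_F rev.pderiv2_F ta tb by auto
  obtain S where S: "S \<subseteq> V"
    "\<And>x. x \<in> S \<Longrightarrow> \<exists>y\<in>W. eval_pt x y A = 0 \<and> eval_pt x y B = 0"
    "degree (wt A) \<le> degree (pCons 0 g) * card S"
    by (rule common_zeros[OF P dA dB V(1) lv(1) V(2) W(1) lv(2) W(2)]) blast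
  have "S \<noteq> {}" using S(3) degree_weighted_pos[OF AP dA] by auto
  then obtain x where x: "x \<in> S" by auto
  obtain y where y: "y \<in> W" "eval_pt x y A = 0" "eval_pt x y B = 0" using S(2)[OF x] by auto
  have "a * x\<^sup>2 = b * y\<^sup>2"
    using critical_common_zero[OF _ _ P y(3)] x y S(1) by (auto simp: V_def W_def)
  moreover have "eval_pt x y Q \<noteq> 0"
  proof
    assume Q: "eval_pt x y Q = 0"
    have "pCons 0 f - [:poly (pCons 0 g) y:] = poly P [:y:]"
      by (simp only: diff_poly_altdef poly_diff const_hom.poly_map_poly_hom) simp
    also have "\<dots> = poly Q [:y:] * poly A [:y:] * poly B [:y:]" by (simp add: P)
    finally have "pderiv (pderiv (pCons 0 f - [:poly (pCons 0 g) y:]))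
        = pderiv (pderiv (poly Q [:y:] * poly A [:y:] * poly B [:y:]))" by (rule arg_cong)
    moreover have "pderiv (pCons 0 f - [:poly (pCons 0 g) y:]) = ?v"
      by (subst pderiv_diff) (simp add: pderiv_pCons)
    ultimately have "[:2 * a:] = pderiv (pderiv (poly Q [:y:] * poly A [:y:] * poly B [:y:]))"
      by (simp only: pderiv2_F)
    \<comment> \<open>Each term of the second derivative of a product of three factors keeps one
      factor undifferentiated, and all three vanish at x.\<close>
    from arg_cong[OF this, of "\<lambda>p. poly p x"] have "2 * a = 0"
      using Q y(2,3) by (simp add: eval_pt_altdef pderiv_mult pderiv_add)
    thus False using ta by simp
  qed
  ultimately show thesis by (rule that)
qed

section \<open>Descent to the ground field\<close>

lemma is_unit_poly_poly_iff:
  "A dvd 1 \<longleftrightarrow> (\<exists>c. c \<noteq> 0 \<and> A = [:[:c:]:])" for A :: "'a::field poly poly"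
  by (auto simp: is_unit_poly_iff dvd_field_iff)

text \<open>The coefficient embedding preserves the degrees in Y and in X, so nonunit factors over K
  stay nonunits over the closure.\<close>

lemma is_unit_map_to_ac:
  assumes "map_poly (map_poly to_ac) A dvd 1"
  shows "A dvd 1"
proof -
  obtain c where c: "c \<noteq> 0" "map_poly (map_poly to_ac) A = [:[:c:]:]"
    using assms by (auto simp: is_unit_poly_poly_iff)
  have "degree (map_poly (map_poly to_ac) A) = degree A"
    by (intro degree_map_poly) (auto simp: map_poly_eq_0_iff)
  hence "degree A = 0" by (simp add: c)
  then obtain p where p: "A = [:p:]" by (elim degree_eq_zeroE)
  have pc: "map_poly to_ac p = [:c:]" using c by (simp add: p map_poly_pCons)
  have "degree (map_poly to_ac p) = degree p"
    by (intro degree_map_poly) auto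
  hence "degree p = 0" by (simp add: pc)
  then obtain k where k: "p = [:k:]" by (elim degree_eq_zeroE)
  have "k \<noteq> 0" using pc c by (auto simp: k map_poly_pCons)
  thus ?thesis by (auto simp: is_unit_poly_poly_iff p k)
qed

lemma not_unit_if_zero: "eval_pt x y A = 0 \<Longrightarrow> \<not> A dvd 1" for A :: "'a::field poly poly"
  by (auto simp: is_unit_poly_poly_iff)

section \<open>The quadratic factor X^2 - e Y^2\<close>

lemma subst2_sum:
  assumes "degree f \<le> n"
  shows "subst2 f P = (\<Sum>i\<le>n. [:[:coeff f i:]:] * P ^ i)"
proof -
  have "degree (map_poly (\<lambda>c. [:[:c:]:]) f) \<le> n"
    using assms map_poly_degree_leq[of "\<lambda>c. [:[:c:]:]" f] by simp
  hence "poly (map_poly (\<lambda>c. [:[:c:]:]) f) P =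
      (\<Sum>i\<le>n. coeff (map_poly (\<lambda>c. [:[:c:]:]) f) i * P ^ i)"
    unfolding poly_altdef by (intro sum.mono_neutral_left) (auto simp: coeff_eq_0)
  thus ?thesis unfolding subst2_def by (simp add: coeff_map_poly)
qed

text \<open>The terms of degree 2 k combine to a multiple of (X^2)^k - (e Y^2)^k, which X^2 - e Y^2
  divides.\<close>

lemma diff_poly_even_dvd:
  fixes F G :: "'a::comm_ring_1 poly"
  assumes F: "\<And>i. odd i \<Longrightarrow> coeff F i = 0" and G: "\<And>i. odd i \<Longrightarrow> coeff G i = 0"
    and FG: "\<And>k. coeff G (2 * k) = e ^ k * coeff F (2 * k)"
  shows "varX\<^sup>2 - [:[:e:]:] * varY\<^sup>2 dvd diff_poly F G"
proof -
  let ?Q = "varX\<^sup>2 - [:[:e:]:] * varY\<^sup>2 :: 'a poly poly"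
  define n where "n = max (degree F) (degree G)"
  have "diff_poly F G = (\<Sum>i\<le>n. [:[:coeff F i:]:] * varX ^ i - [:[:coeff G i:]:] * varY ^ i)"
    unfolding diff_poly_def by (subst (1 2) subst2_sum[of _ n]) (simp_all add: n_def sum_subtractf)
  also have "?Q dvd \<dots>"
  proof (rule dvd_sum)
    fix i
    show "?Q dvd [:[:coeff F i:]:] * varX ^ i - [:[:coeff G i:]:] * varY ^ i"
    proof (cases "odd i")
      case True
      thus ?thesis by (simp add: F G)
    next
      case False
      then obtain k where k: "i = 2 * k" by (auto elim: evenE)
      have "?Q dvd (varX\<^sup>2) ^ k - ([:[:e:]:] * varY\<^sup>2) ^ k"
        by (rule diff_dvd_power_diff)
      also have "(varX\<^sup>2) ^ k - ([:[:e:]:] * varY\<^sup>2) ^ k dvd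
          [:[:coeff F i:]:] * ((varX\<^sup>2) ^ k - ([:[:e:]:] * varY\<^sup>2) ^ k)"
        by (rule dvd_triv_right)
      also have "\<dots> = [:[:coeff F i:]:] * varX ^ i - [:[:coeff G i:]:] * varY ^ i"
      proof -
        have "[:[:coeff G i:]:] = [:[:coeff F i:]:] * [:[:e:]:] ^ k"
          unfolding k FG by (simp add: poly_const_pow mult_ac)
        note cG = this
        show ?thesis
          unfolding cG unfolding k
          by (simp only: power_mult power_mult_distrib right_diff_distrib mult.assoc)
      qed
      finally show ?thesis .
    qed
  qed
  finally show ?thesis .
qed

lemma linear_factorization:
  "varX\<^sup>2 - [:[:d\<^sup>2:]:] * varY\<^sup>2 = (varX - [:[:d:]:] * varY) * (varX + [:[:d:]:] * varY)"
proof -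
  have "[:[:d\<^sup>2:]:] = [:[:d:]:]\<^sup>2" by (simp add: poly_const_pow)
  thus ?thesis by (simp only:) (simp add: power2_eq_square algebra_simps)
qed

interpretation to_ac_hom2: coeff_hom "map_poly (map_poly to_ac)"
  by (intro coeff_hom.coeff_hom_map_poly to_ac_hom.coeff_hom_axioms)

lemma (in additive_pair) closure_pair: "additive_pair (map_poly to_ac f) (map_poly to_ac g) (to_ac a) (to_ac b)"
proof
  show "additive_poly (map_poly to_ac f)" "additive_poly (map_poly to_ac g)"
    using additive_poly_map addf addg to_ac_hom.coeff_hom_axioms by blast+
  show "(2 :: 'a alg_closure) \<noteq> 0"
    using two to_ac_eq_0_iff[of "2::'a"] by (simp del: to_ac_eq_0_iff)
qed (use a b in \<open>simp_all add: coeff_map_poly\<close>)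

lemma linear_poly_root:
  fixes p :: "'a::field poly"
  assumes "degree p = 1"
  obtains u where "poly p u = 0"
proof -
  have "coeff p 1 \<noteq> 0" using assms leading_coeff_0_iff[of p] by auto
  hence "poly p (- coeff p 0 / coeff p 1) = 0" using assms by (simp add: poly_altdef)
  thus thesis by (rule that)
qed

section \<open>Polynomials over K related by a scaling over the closure\<close>

locale scaled_pair = additive_pair f g a b for f g :: "'a::field poly" and a b +
  fixes \<delta> :: "'a alg_closure"
  assumes nz: "\<delta> \<noteq> 0"
    and scaled: "map_poly to_ac g = smult \<delta> (pcompose (map_poly to_ac f) [:0, \<delta>:])"
begin

lemma coeff_scaled: "to_ac (coeff g i) = \<delta> ^ Suc i * to_ac (coeff f i)"
proof -
  have "to_ac (coeff g i) = coeff (map_poly to_ac g) i" by (simp add: coeff_map_poly)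
  thus ?thesis unfolding scaled by (simp add: coeff_pcompose_linear coeff_map_poly)
qed

text \<open>Comparing linear coefficients gives b = \<delta>^2 a, so \<delta>^2 lies in K whether or
  not \<delta> does.\<close>

lemma square: "to_ac (b / a) = \<delta>\<^sup>2"
  using coeff_scaled[of 1] a b by (simp add: power2_eq_square)

lemma degree_scaled: "degree g = degree f"
proof -
  have "degree (map_poly to_ac g) = degree (map_poly to_ac f)"
    unfolding scaled using nz by (simp add: degree_pcompose)
  thus ?thesis by (simp add: degree_map_poly)
qed

text \<open>f and g have only odd exponents, so F and G have only even ones, and the scaling
  multiplies the coefficient of degree 2 k by \<delta>^(2 k) = (b / a)^k. Writing b / a for
  \<delta>^2 keeps the factor in K[X,Y].\<close>

lemma quadratic_factor: "varX\<^sup>2 - [:[:b / a:]:] * varY\<^sup>2 dvd P"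
proof (rule diff_poly_even_dvd)
  show "coeff (pCons 0 f) i = 0" "coeff (pCons 0 g) i = 0" if "odd i" for i
    using that additive_poly_coeff_even[OF addf two] additive_poly_coeff_even[OF addg two]
    by (cases i; simp)+
  show "coeff (pCons 0 g) (2 * k) = (b / a) ^ k * coeff (pCons 0 f) (2 * k)" for k
  proof (cases k)
    case (Suc m)
    have "to_ac (coeff g (Suc (2 * m))) = (\<delta>\<^sup>2) ^ k * to_ac (coeff f (Suc (2 * m)))"
    proof -
      have "Suc (Suc (2 * m)) = 2 * k" by (simp add: Suc)
      thus ?thesis unfolding coeff_scaled by (simp only: power_mult)
    qed
    also have "\<dots> = to_ac ((b / a) ^ k * coeff f (Suc (2 * m)))"
      by (simp only: square[symmetric] to_ac_mult to_ac_power)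
    finally have "coeff g (Suc (2 * m)) = (b / a) ^ k * coeff f (Suc (2 * m))"
      by (simp only: to_ac_eq_iff)
    thus ?thesis by (simp add: Suc)
  qed simp
qed

lemma map_quadratic:
  "map_poly (map_poly to_ac) (varX\<^sup>2 - [:[:b / a:]:] * varY\<^sup>2) =
    (varX - [:[:\<delta>:]:] * varY) * (varX + [:[:\<delta>:]:] * varY)"
proof -
  have "map_poly (map_poly to_ac) (varX\<^sup>2 - [:[:b / a:]:] * varY\<^sup>2)
      = varX\<^sup>2 - [:[:to_ac (b / a):]:] * varY\<^sup>2"
    unfolding power2_eq_square to_ac_hom2.hom_diff to_ac_hom2.hom_mult
    by (simp add: map_poly_varX map_poly_varY map_poly_pCons)
  thus ?thesis unfolding square linear_factorization .
qed

text \<open>\<open>degree g > 1\<close> gives P a Y-degree above 2, so the cofactor is not constant.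
  A nontrivial splitting of it would give, over the closure, a point with a x^2 = b y^2 where the
  quadratic factor is nonzero, yet that equation says that this factor vanishes.\<close>

lemma irreducible_cofactor:
  assumes "degree g > 1"
  obtains H where "irreducible H" "P = (varX\<^sup>2 - [:[:b / a:]:] * varY\<^sup>2) * H"
proof -
  let ?Q = "varX\<^sup>2 - [:[:b / a:]:] * varY\<^sup>2 :: 'a poly poly"
  let ?m = "map_poly (map_poly to_ac) :: 'a poly poly \<Rightarrow> _"
  obtain H where H: "P = ?Q * H" using quadratic_factor by (elim dvdE)
  have "\<not> H dvd 1"
  proof
    assume "H dvd 1"
    then obtain c where c: "c \<noteq> 0" "H = [:[:c:]:]" by (auto simp: is_unit_poly_poly_iff)
    have "degree P = degree ?Q" unfolding H c(2) using c(1) by simp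
    also have "\<dots> \<le> 2"
      by (intro degree_diff_le degree_mult_le[THEN order_trans])
        (simp_all add: varX_def varY_def power2_eq_square)
    finally show False
      using assms rev.degree_pCons_f degree_diff_poly(1)[OF degG, of "pCons 0 f"] by simp
  qed
  moreover have "A dvd 1 \<or> B dvd 1" if "H = A * B" for A B
  proof (rule ccontr)
    assume n: "\<not> (A dvd 1 \<or> B dvd 1)"
    have "P = ?Q * A * B" using H that by (simp add: mult.assoc)
    from arg_cong[OF this, of ?m]
    have "diff_poly (pCons 0 (map_poly to_ac f)) (pCons 0 (map_poly to_ac g)) = ?m ?Q * ?m A * ?m B"
      by (simp only: map_poly_diff_poly[OF to_ac_hom.coeff_hom_axioms] to_ac_hom2.hom_mult
          to_ac_hom.map_poly_hom_pCons to_ac_0)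
    then obtain x y where xy: "to_ac a * x\<^sup>2 = to_ac b * y\<^sup>2" "eval_pt x y (?m ?Q) \<noteq> 0"
      using two_factors_common_zero[OF closure_pair] n is_unit_map_to_ac by metis
    have "x\<^sup>2 = to_ac (b / a) * y\<^sup>2"
      using xy(1) a by (simp add: field_simps)
    hence "eval_pt x y (?m ?Q) = 0"
      unfolding map_quadratic square eval_pt_hom.hom_diff eval_pt_hom.hom_add eval_pt_hom.hom_mult
        id_hom.eval2_simps
      by (simp add: power2_eq_square algebra_simps)
    thus False using xy(2) by simp
  qed
  moreover have "H \<noteq> 0" using P_nonzero H by auto
  ultimately show thesis using H by (intro that[of H]) (auto simp: irreducible_def)
qed

text \<open>Here P is quadratic in Y, so the leading form of A is linear and has a root u in K. It
  is also a root of \<open>lf P\<close>, so a = b u^2, whence (\<delta> u)^2 = 1 and \<delta> is 1 /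
  u or -1 / u.\<close>

lemma linear_scaling:
  assumes "degree f = 1" and P: "P = A * B" "\<not> A dvd 1" "\<not> B dvd 1"
  shows "\<delta> \<in> range to_ac"
proof -
  have AB: "A dvd P" "B dvd P" by (simp_all add: P(1))
  have d1: "degree (lf A) > 0" "degree (lf B) > 0"
    using degree_nonunit AB P(2,3) by (simp_all only: degree_lf_dvd)
  have nz': "A \<noteq> 0" "B \<noteq> 0" using P_nonzero P(1) by auto
  have g1: "degree g = 1" using degree_scaled assms(1) by simp
  have "degree A + degree B = degree P" using nz' by (simp add: P(1) degree_mult_eq)
  also have "\<dots> = 2"
    using degree_diff_poly(1)[OF degG, of "pCons 0 f"] rev.degree_pCons_f g1 by simp
  finally have "degree (lf A) = 1" using d1 unfolding AB[THEN degree_lf_dvd] by linarith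
  then obtain u where "poly (lf A) u = 0" by (rule linear_poly_root)
  hence "poly (lf P) u = 0" unfolding P(1) lf_mult by (simp only: poly_mult mult_zero_left)
  hence "lead_coeff (pCons 0 f) = lead_coeff (pCons 0 g) * u ^ degree (pCons 0 g)"
    unfolding weighted_P(2) poly_diff poly_monom 
    by (simp only: poly_pCons poly_0 mult_zero_right add_0_right right_minus_eq)
  hence "a = b * u\<^sup>2"
    using assms(1) g1 a b unfolding degree_pCons_f rev.degree_pCons_f by (simp add: numeral_2_eq_2)
  hence "to_ac a = to_ac a * (\<delta> * to_ac u)\<^sup>2"
    using square a by (simp add: field_simps power2_eq_square flip: to_ac_mult)
  hence "(\<delta> * to_ac u)\<^sup>2 = 1" using a by simp
  hence "\<delta> * to_ac u = 1 \<or> \<delta> * to_ac u = -1" by (simp add: power2_eq_1_iff)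
  moreover have "to_ac u \<noteq> 0" using \<open>(\<delta> * to_ac u)\<^sup>2 = 1\<close> by auto
  ultimately have "\<delta> = 1 / to_ac u \<or> \<delta> = - 1 / to_ac u"
    by (metis nonzero_eq_divide_eq)
  hence "\<delta> = to_ac (1 / u) \<or> \<delta> = to_ac (- 1 / u)" by simp
  thus ?thesis by blast
qed

end

text \<open>Since \<delta> may lie outside K, the factorisation in the second claim is stated over
  the closure, while \<open>H\<close> and its irreducibility are over K.\<close>

theorem theorem1p1:
  fixes f g F G :: "'a::field poly" and p :: nat
  assumes char: "CHAR('a) = p" and p2: "p > 2"
    and addf: "additive_poly f" and addg: "additive_poly g"
    and deriv: "poly (pderiv f) 0 * poly (pderiv g) 0 \<noteq> 0"
    and F_eq: "F = [:0, 1:] * f" and G_eq: "G = [:0, 1:] * g"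
  shows "(reducible (subst2 F varX - subst2 G varY) \<longleftrightarrow>
            (\<exists>\<delta>::'a alg_closure. \<delta> \<noteq> 0 \<and>
               map_poly to_ac g = smult \<delta> (pcompose (map_poly to_ac f) [:0, \<delta>:]) \<and>
               (degree f > 1 \<or> \<delta> \<in> range to_ac))) \<and>
         (\<forall>\<delta>::'a alg_closure.
            \<delta> \<noteq> 0 \<longrightarrow>
            map_poly to_ac g = smult \<delta> (pcompose (map_poly to_ac f) [:0, \<delta>:]) \<longrightarrow>
            degree g > 1 \<longrightarrow>
            \<delta>\<^sup>2 \<in> range to_ac \<and>
            (\<exists>H :: 'a poly poly. irreducible H \<and>
               map_poly (map_poly to_ac) (subst2 F varX - subst2 G varY) =
                 (varX - [:[:\<delta>:]:] * varY) * (varX + [:[:\<delta>:]:] * varY) *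
                 map_poly (map_poly to_ac) H))"
proof -
  define a where "a = coeff f 1"
  define b where "b = coeff g 1"
  have "\<not> CHAR('a) dvd 2" using char p2 by (auto dest: dvd_imp_le)
  hence "of_nat 2 \<noteq> (0::'a)" using of_nat_eq_0_iff_char_dvd[where 'a = 'a, of 2] by simp
  then interpret additive_pair f g a b
    using addf addg deriv
    by unfold_locales (auto simp: a_def b_def poly_0_coeff_0 coeff_pderiv)
  have P_eq: "subst2 F varX - subst2 G varY = P"
    by (simp add: F_eq G_eq diff_poly_def)
  show ?thesis
    unfolding P_eq
  proof (intro conjI iffI allI impI; (elim exE conjE)?)
    show "\<delta>\<^sup>2 \<in> range to_ac"
      if "\<delta> \<noteq> 0" "map_poly to_ac g = smult \<delta> (pcompose (map_poly to_ac f) [:0, \<delta>:])" for \<delta>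
    proof -
      interpret scaled_pair f g a b \<delta> using that by unfold_locales
      show ?thesis using square by (metis rangeI)
    qed
    show H: "\<exists>H. irreducible H \<and> map_poly (map_poly to_ac) P =
        (varX - [:[:\<delta>:]:] * varY) * (varX + [:[:\<delta>:]:] * varY) * map_poly (map_poly to_ac) H"
      if "\<delta> \<noteq> 0" "map_poly to_ac g = smult \<delta> (pcompose (map_poly to_ac f) [:0, \<delta>:])"
        and dg: "degree g > 1" for \<delta>
    proof -
      interpret scaled_pair f g a b \<delta> using that by unfold_locales
      obtain H where "irreducible H" "P = (varX\<^sup>2 - [:[:b / a:]:] * varY\<^sup>2) * H"
        using irreducible_cofactor[OF dg] by blast
      thus ?thesis
        using map_quadratic
        by (intro exI[of _ H]) (simp add: to_ac_hom2.hom_mult)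
    qed
    show "reducible P"
      if "\<delta> \<noteq> 0" "map_poly to_ac g = smult \<delta> (pcompose (map_poly to_ac f) [:0, \<delta>:])"
        "degree f > 1 \<or> \<delta> \<in> range to_ac" for \<delta>
    proof -
      interpret scaled_pair f g a b \<delta> using that by unfold_locales
      note eval = eval_pt_hom.hom_add eval_pt_hom.hom_diff eval_pt_hom.hom_mult id_hom.eval2_simps
      \<comment> \<open>For \<open>degree f > 1\<close> the quadratic factor and its cofactor serve;
        for \<delta> in K the linear factors are themselves defined over K.\<close>
      have "\<exists>A B. P = A * B \<and> \<not> A dvd 1 \<and> \<not> B dvd 1"
        using that(3)
      proof
        assume "degree f > 1"
        then obtain H where H: "irreducible H" "P = (varX\<^sup>2 - [:[:b / a:]:] * varY\<^sup>2) * H"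
          using irreducible_cofactor degree_scaled by metis
        moreover have "\<not> (varX\<^sup>2 - [:[:b / a:]:] * varY\<^sup>2) dvd 1"
          by (rule not_unit_if_zero[of 0 0], unfold power2_eq_square eval) simp
        ultimately show ?thesis by (auto simp: irreducible_def)
      next
        assume "\<delta> \<in> range to_ac"
        then obtain d where d: "\<delta> = to_ac d" by auto
        have "b / a = d\<^sup>2" using square unfolding d by (simp only: to_ac_power[symmetric] to_ac_eq_iff)
        hence "(varX - [:[:d:]:] * varY) * (varX + [:[:d:]:] * varY) dvd P"
          using quadratic_factor by (simp only: linear_factorization)
        then obtain H where "P = (varX - [:[:d:]:] * varY) * ((varX + [:[:d:]:] * varY) * H)"
          unfolding dvd_def by (simp only: mult.assoc) blast
        moreover have "\<not> (varX - [:[:d:]:] * varY) dvd 1"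
          by (rule not_unit_if_zero[of 0 0]) (unfold eval, simp)
        moreover have "\<not> ((varX + [:[:d:]:] * varY) * H) dvd 1"
          by (rule not_unit_if_zero[of 0 0]) (unfold eval, simp)
        ultimately show ?thesis by blast
      qed
      then obtain A B where AB: "P = A * B" "\<not> A dvd 1" "\<not> B dvd 1" by blast
      hence "\<not> P dvd 1" "\<not> irreducible P"
        by (auto simp: irreducible_def dest: dvd_mult_left)
      thus ?thesis using P_nonzero by (simp add: reducible_def)
    qed
    assume "reducible P"
    then obtain A B where AB: "P = A * B" "\<not> A dvd 1" "\<not> B dvd 1"
      using P_nonzero by (auto simp: reducible_def irreducible_def)
    have "diff_poly (pCons 0 (map_poly to_ac f)) (pCons 0 (map_poly to_ac g))
        = map_poly (map_poly to_ac) A * map_poly (map_poly to_ac) B"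
      using arg_cong[OF AB(1), of "map_poly (map_poly to_ac)"]
      by (simp add: map_poly_diff_poly[OF to_ac_hom.coeff_hom_axioms] to_ac_hom2.hom_mult
          to_ac_hom.map_poly_hom_pCons)
    then obtain \<delta> where \<delta>: "\<delta> \<noteq> 0"
      "map_poly to_ac g = smult \<delta> (pcompose (map_poly to_ac f) [:0, \<delta>:])"
      using factorization_imp_scaling[OF closure_pair] AB(2,3) is_unit_map_to_ac by metis
    then interpret scaled_pair f g a b \<delta> by unfold_locales
    have "degree f > 1 \<or> \<delta> \<in> range to_ac"
    proof (cases "degree f > 1")
      case False
      hence "degree f = 1" using degree_pos by simp
      thus ?thesis using linear_scaling[OF _ AB] by blast
    qed simp
    thus "\<exists>\<delta>. \<delta> \<noteq> 0 \<and> map_poly to_ac g = smult \<delta> (pcompose (map_poly to_ac f) [:0, \<delta>:]) \<and>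
        (degree f > 1 \<or> \<delta> \<in> range to_ac)"
      using \<delta> by blast
  qed
qed

end
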